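(* Let $A$ be a non-unital complex $C^*$-algebra (i.e. a complex $C^*$-algebra not required to possess an identity element). Then $A$ has a non-unital continuous functional calculus over $\mathbb{C}$ for normal elements. That is: $0$ is normal; for every $a\in A$ the quasispectrum $\sigma_{n,\mathbb{C}}(a)\subseteq\mathbb{C}$ is compact; and for every normal $a\in A$ (i.e. $a^*a=aa^*$) there exists a non-unital $*$-homomorphism of $\mathbb{C}$-algebras $\varphi : C(\sigma_{n,\mathbb{C}}(a),\mathbb{C})_0\to A$ such that (1) $\varphi$ is a closed embedding of topological spaces; (2) $\varphi$ sends the restriction of the identity function $z\mapsto z$ to $\sigma_{n,\mathbb{C}}(a)$ to $a$; (3) for every $f\in C(\sigma_{n,\mathbb{C}}(a),\mathbb{C})_0$, the quasispectrum $\sigma_{n,\mathbb{C}}(\varphi(f))$ equals the range of $f$; (4) for every $f\in C(\sigma_{n,\mathbb{C}}(a),\mathbb{C})_0$, the element $\varphi(f)$ is normal.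
   Context: For a (possibly non-unital) ring $A$, an element $x\in A$ is quasiregular if there is $y\in A$ with $x+y+xy=0=y+x+yx$. For a non-unital algebra $A$ over a semifield $R$ and $a\in A$, the quasispectrum $\sigma_{n,R}(a)\subseteq R$ is the set of $r\in R$ such that either $r=0$ or $-(r^{-1}a)$ is not quasiregular in $A$. In particular $0\in\sigma_{n,R}(a)$ always. For a set $s\subseteq \mathbb{C}$ containing $0$, $C(s,\mathbb{C})_0$ denotes the non-unital $*$-algebra (pointwise operations, complex conjugation as star) of continuous functions $f:s\to\mathbb{C}$ with $f(0)=0$, with the compact-open topology (the topology of uniform convergence when $s$ is compact). A non-unital $*$-homomorphism is a linear, multiplicative, star-preserving map. *)

theory Defs
  imports "HOL-Analysis.Analysis"
begin

text \<open>
  Complex algebras, not assumed to have a unit. As the normed and topological classes of the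
  library are built over \<^class>\<open>real_vector\<close>, the complex scalar multiplication is required to
  extend the real one.
\<close>

class complex_algebra = real_algebra +
  fixes scaleC :: "complex \<Rightarrow> 'a \<Rightarrow> 'a"  (infixr \<open>*\<^sub>C\<close> 75)
  assumes scaleR_scaleC: "scaleR r x = complex_of_real r *\<^sub>C x"
    and scaleC_add_right: "c *\<^sub>C (x + y) = c *\<^sub>C x + c *\<^sub>C y"
    and scaleC_add_left: "(c + d) *\<^sub>C x = c *\<^sub>C x + d *\<^sub>C x"
    and scaleC_scaleC: "c *\<^sub>C d *\<^sub>C x = (c * d) *\<^sub>C x"
    and scaleC_one: "1 *\<^sub>C x = x"
    and mult_scaleC_left: "(c *\<^sub>C x) * y = c *\<^sub>C (x * y)"
    and mult_scaleC_right: "x * (c *\<^sub>C y) = c *\<^sub>C (x * y)"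

class complex_star_algebra = complex_algebra +
  fixes star :: "'a \<Rightarrow> 'a"
  assumes star_star: "star (star x) = x"
    and star_add: "star (x + y) = star x + star y"
    and star_scaleC: "star (c *\<^sub>C x) = cnj c *\<^sub>C star x"
    and star_mult: "star (x * y) = star y * star x"

class nonunital_cstar_algebra = complex_star_algebra + real_normed_algebra + banach +
  assumes norm_scaleC: "norm (c *\<^sub>C x) = cmod c * norm x"
    and norm_star_mult_self: "norm (star x * x) = norm x * norm x"

definition normal_element :: "'a::complex_star_algebra \<Rightarrow> bool"
  where "normal_element a \<longleftrightarrow> star a * a = a * star a"

definition quasiregular :: "'a::ring \<Rightarrow> bool"
  where "quasiregular x \<longleftrightarrow> (\<exists>y. x + y + x * y = 0 \<and> y + x + y * x = 0)"

definition quasispectrum :: "'a::complex_algebra \<Rightarrow> complex set"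
  where "quasispectrum a = {r. r = 0 \<or> \<not> quasiregular (- (inverse r *\<^sub>C a))}"

text \<open>
  The algebra $C(s,\mathbb{C})_0$. A function on \<open>s\<close> is represented by its extension by zero to
  all of the complex plane, so that the pointwise operations need no restriction to \<open>s\<close>; the
  extension itself need not be continuous.
\<close>

definition C0 :: "complex set \<Rightarrow> (complex \<Rightarrow> complex) set"
  where "C0 s = {f. continuous_on s f \<and> f 0 = 0 \<and> (\<forall>z. z \<notin> s \<longrightarrow> f z = 0)}"

definition C0_id :: "complex set \<Rightarrow> complex \<Rightarrow> complex"
  where "C0_id s = (\<lambda>z. if z \<in> s then z else 0)"

text \<open>
  The compact-open topology. The underlying set is all of \<^term>\<open>C0 s\<close>, which is the
  subbasic set for \<^prop>\<open>K = {}\<close>.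
\<close>

definition C0_topology :: "complex set \<Rightarrow> (complex \<Rightarrow> complex) topology"
  where "C0_topology s =
    topology_generated_by {{f \<in> C0 s. f ` K \<subseteq> U} | K U. compact K \<and> K \<subseteq> s \<and> open U}"

definition C0_star_hom ::
    "complex set \<Rightarrow> ((complex \<Rightarrow> complex) \<Rightarrow> 'a::complex_star_algebra) \<Rightarrow> bool"
  where "C0_star_hom s \<phi> \<longleftrightarrow>
    (\<forall>f\<in>C0 s. \<forall>g\<in>C0 s. \<phi> (\<lambda>z. f z + g z) = \<phi> f + \<phi> g) \<and>
    (\<forall>c. \<forall>f\<in>C0 s. \<phi> (\<lambda>z. c * f z) = c *\<^sub>C \<phi> f) \<and>
    (\<forall>f\<in>C0 s. \<forall>g\<in>C0 s. \<phi> (\<lambda>z. f z * g z) = \<phi> f * \<phi> g) \<and>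
    (\<forall>f\<in>C0 s. \<phi> (\<lambda>z. cnj (f z)) = star (\<phi> f))"

definition closed_embedding_map :: "'a topology \<Rightarrow> 'b topology \<Rightarrow> ('a \<Rightarrow> 'b) \<Rightarrow> bool"
  where "closed_embedding_map X Y f \<longleftrightarrow> embedding_map X Y f \<and> closedin Y (f ` topspace X)"

end

theory Submission imports Defs begin


text \<open>
  Adjoin a unit to \<open>A\<close>; the quasispectrum of \<open>a\<close> is then the spectrum of \<open>a\<close> in the unitization,
  and for normal \<open>a\<close> everything takes place in the bicommutant \<open>B\<close> of \<open>a\<close> and its adjoint, a
  commutative \<open>C\<^sup>*\<close>-algebra that contains the inverses of its elements. Averaging resolvents over
  roots of unity shows that \<open>x\<^sup>n\<close> tends to \<open>0\<close> modulo a closed ideal of \<open>B\<close> as soon as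
  \<open>1 - z x\<close> is invertible modulo that ideal for all \<open>z\<close> in the unit disc. For a maximal ideal this
  gives the Gelfand-Mazur theorem, hence enough characters to detect the spectrum; for the zero
  ideal it gives, with the \<open>C\<^sup>*\<close>-identity, a character attaining the norm. So the Gelfand
  transform is isometric, and by Stone-Weierstrass and completeness every continuous function on
  the spectrum of \<open>a\<close>, composed with the transform of \<open>a\<close>, is itself the transform of an element
  of \<open>B\<close>. The scalar part of the unitization is a character vanishing at \<open>a\<close>, so functions
  vanishing at \<open>0\<close> land in \<open>A\<close>.
\<close>

section \<open>Complex algebras\<close>

text \<open>The quotient of \<open>B\<close> by an ideal is never formed: congruence modulo
  \<open>M\<close> is membership of a difference in \<open>M\<close>, and the quotient norm is the
  distance to \<open>M\<close>. One estimate can therefore serve both the maximal ideals and the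
  zero ideal. In it, finite averages over roots of unity play the part of Cauchy's formula and
  Liouville's theorem. The obstacle is that smallness of \<open>r^n x^n\<close> has to be carried
  from radius 0 to radius 1 in steps whose length does not depend on \<open>n\<close>; compactness
  of the disc supplies such a length through a bound on the inverses. Both applications are by
  contradiction: a counterexample to Gelfand-Mazur is itself invertible modulo \<open>M\<close>, so
  its suitably scaled powers stay away from 0, and a self-adjoint element of norm 1 has powers of
  norm 1 at all exponents \<open>2^n\<close>. The bicommutant is preferred to the closed algebra
  generated by \<open>a\<close> and its adjoint because a commutant contains inverses for a purely
  algebraic reason.\<close>

lemma scaleC_zero_left [simp]: "0 *\<^sub>C x = (0::'a::complex_algebra)"
  using scaleC_add_left[of 0 0 x] by simp

lemma scaleC_zero_right [simp]: "c *\<^sub>C 0 = (0::'a::complex_algebra)"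
  using scaleC_add_right[of c "0::'a" 0] by simp

lemma scaleC_minus_left [simp]: "(- c) *\<^sub>C x = - (c *\<^sub>C x)" for x :: "'a::complex_algebra"
  using scaleC_add_left[of "- c" c x] by (simp add: add_eq_0_iff)

lemma scaleC_minus_right [simp]: "c *\<^sub>C (- x) = - (c *\<^sub>C x)" for x :: "'a::complex_algebra"
  using scaleC_add_right[of c "- x" x] by (simp add: add_eq_0_iff)

lemma scaleC_diff_left: "(c - d) *\<^sub>C x = c *\<^sub>C x - d *\<^sub>C x" for x :: "'a::complex_algebra"
  using scaleC_add_left[of c "- d" x] by simp

lemma scaleC_diff_right: "c *\<^sub>C (x - y) = c *\<^sub>C x - c *\<^sub>C y" for x :: "'a::complex_algebra"
  using scaleC_add_right[of c x "- y"] by simp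

lemma scaleC_sum_left: "(\<Sum>i\<in>I. c i) *\<^sub>C (x::'a::complex_algebra) = (\<Sum>i\<in>I. c i *\<^sub>C x)"
  by (induction I rule: infinite_finite_induct) (auto simp: scaleC_add_left)

declare scaleC_one [simp] scaleC_scaleC [simp] mult_scaleC_left [simp] mult_scaleC_right [simp]
  star_star [simp]

lemma star_0 [simp]: "star (0::'a::complex_star_algebra) = 0"
  using star_add[of "0::'a" 0] by simp

lemma star_minus: "star (- x) = - star x" for x :: "'a::complex_star_algebra"
  using star_add[of "- x" x] by (simp add: add_eq_0_iff)

lemma star_diff: "star (x - y) = star x - star y" for x :: "'a::complex_star_algebra"
  using star_add[of x "- y"] by (simp add: star_minus)

text \<open>Dividing the C*-identity by \<open>norm y\<close> gives one inequality; applying it to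
  \<open>x\<close> and to \<open>star x\<close> gives both.\<close>

lemma norm_star [simp]: "norm (star x) = norm x" for x :: "'a::nonunital_cstar_algebra"
proof -
  have le: "norm y \<le> norm (star y)" for y :: 'a
  proof (cases "y = 0")
    case False
    have "norm y * norm y \<le> norm (star y) * norm y"
      using norm_mult_ineq[of "star y" y] norm_star_mult_self[of y] by simp
    then show ?thesis using False by simp
  qed simp
  show ?thesis using le[of x] le[of "star x"] by simp
qed

class unital_cstar_algebra = nonunital_cstar_algebra + real_normed_algebra_1

lemma star_1 [simp]: "star (1::'a::unital_cstar_algebra) = 1"
proof -
  have "star (1::'a) = star (star (star 1 * 1))" by simp
  also have "\<dots> = 1" by (subst star_mult) simp
  finally show ?thesis .
qed

section \<open>Unitization\<close>

text \<open>\<open>Unitization c x\<close> stands for the formal sum \<open>c 1 + x\<close>.\<close>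

datatype 'a unitization = Unitization (scal: complex) (elt: 'a)

text \<open>Left multiplication by \<open>u\<close> on \<open>A\<close>, which is an ideal of its
  unitization. Its operator norm is the candidate for the C*-norm of \<open>u\<close>.\<close>

definition lmult :: "'a::complex_algebra unitization \<Rightarrow> 'a \<Rightarrow> 'a"
  where "lmult u x = scal u *\<^sub>C x + elt u * x"

instantiation unitization :: (complex_algebra) "{complex_algebra, ring_1}"
begin

definition "0 = Unitization 0 0"
definition "1 = Unitization 1 0"
definition "u + v = Unitization (scal u + scal v) (elt u + elt v)"
definition "u - v = Unitization (scal u - scal v) (elt u - elt v)"
definition "- u = Unitization (- scal u) (- elt u)"
definition "u * v = Unitization (scal u * scal v) (scal u *\<^sub>C elt v + scal v *\<^sub>C elt u + elt u * elt v)"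
definition "c *\<^sub>C u = Unitization (c * scal u) (c *\<^sub>C elt u)"
definition "(r::real) *\<^sub>R u = Unitization (r *\<^sub>R scal u) (r *\<^sub>R elt u)"

lemma unitization_sel [simp]:
  "scal (0::'a unitization) = 0" "elt (0::'a unitization) = 0"
  "scal (1::'a unitization) = 1" "elt (1::'a unitization) = 0"
  "scal (u + v) = scal u + scal v" "elt (u + v) = elt u + elt v"
  "scal (u - v) = scal u - scal v" "elt (u - v) = elt u - elt v"
  "scal (- u) = - scal u" "elt (- u) = - elt u"
  "scal (u * v) = scal u * scal v"
  "elt (u * v) = scal u *\<^sub>C elt v + scal v *\<^sub>C elt u + elt u * elt v"
  "scal (c *\<^sub>C u) = c * scal u" "elt (c *\<^sub>C u) = c *\<^sub>C elt u"
  "scal (r *\<^sub>R u) = r *\<^sub>R scal u" "elt (r *\<^sub>R u) = r *\<^sub>R elt u"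
  for u v :: "'a unitization"
  by (simp_all add: zero_unitization_def one_unitization_def plus_unitization_def
      minus_unitization_def uminus_unitization_def times_unitization_def
      scaleC_unitization_def scaleR_unitization_def)

instance
proof
  fix a b c :: "'a unitization" and r s :: real and z w :: complex
  note [intro!] = unitization.expand
  show "a + b + c = a + (b + c)" "a + b = b + a" "0 + a = a" "- a + a = 0" "a - b = a + - b"
    by (auto simp: algebra_simps)
  show "r *\<^sub>R (a + b) = r *\<^sub>R a + r *\<^sub>R b" "(r + s) *\<^sub>R a = r *\<^sub>R a + s *\<^sub>R a"
    "r *\<^sub>R s *\<^sub>R a = (r * s) *\<^sub>R a" "1 *\<^sub>R a = a"
    by (auto simp: algebra_simps)
  show "a * b * c = a * (b * c)"
    by (auto simp: algebra_simps scaleC_add_right)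
  show "(a + b) * c = a * c + b * c" "a * (b + c) = a * b + a * c"
    by (auto simp: algebra_simps scaleC_add_right scaleC_add_left)
  show "1 * a = a" "a * 1 = a"
    by auto
  show "(r *\<^sub>R a) * b = r *\<^sub>R (a * b)" "a * (r *\<^sub>R b) = r *\<^sub>R (a * b)"
    by (auto simp: scaleR_scaleC scaleC_add_right scaleR_conv_of_real mult_ac)
  show "r *\<^sub>R a = complex_of_real r *\<^sub>C a"
    by (auto simp: scaleR_scaleC scaleR_conv_of_real)
  show "z *\<^sub>C (a + b) = z *\<^sub>C a + z *\<^sub>C b" "(z + w) *\<^sub>C a = z *\<^sub>C a + w *\<^sub>C a"
    "z *\<^sub>C w *\<^sub>C a = (z * w) *\<^sub>C a" "1 *\<^sub>C a = a"
    by (auto simp: algebra_simps scaleC_add_right scaleC_add_left)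
  show "(z *\<^sub>C a) * b = z *\<^sub>C (a * b)" "a * (z *\<^sub>C b) = z *\<^sub>C (a * b)"
    by (auto simp: scaleC_add_right mult_ac)
  show "(0::'a unitization) \<noteq> 1"
    by (simp add: zero_unitization_def one_unitization_def)
qed

end

instantiation unitization :: (complex_star_algebra) complex_star_algebra
begin

definition "star u = Unitization (cnj (scal u)) (star (elt u))"

lemma star_unitization_sel [simp]: "scal (star u) = cnj (scal u)" "elt (star u) = star (elt u)"
  for u :: "'a unitization"
  by (simp_all add: star_unitization_def)

instance
  by standard (simp_all add: unitization.expand star_add star_scaleC star_mult)

end

section \<open>The norm of the unitization\<close>

lemma lmult_mult: "lmult (u * v) x = lmult u (lmult v x)"
  by (simp add: lmult_def algebra_simps scaleC_add_right)

lemma bounded_linear_lmult: "bounded_linear (lmult (u::'a::nonunital_cstar_algebra unitization))"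
proof (rule bounded_linear_intro)
  show "norm (lmult u x) \<le> norm x * (cmod (scal u) + norm (elt u))" for x
  proof -
    have "norm (lmult u x) \<le> cmod (scal u) * norm x + norm (elt u * x)"
      unfolding lmult_def by (metis norm_scaleC norm_triangle_ineq)
    also have "norm (elt u * x) \<le> norm (elt u) * norm x" by (rule norm_mult_ineq)
    finally show ?thesis by (simp add: algebra_simps)
  qed
qed (simp_all add: lmult_def algebra_simps scaleC_add_right scaleR_scaleC)

instantiation unitization :: (nonunital_cstar_algebra) real_normed_algebra_1
begin

text \<open>If \<open>A\<close> already has a unit, the operator norm alone is only a seminorm; hence the maximum.\<close>

definition "norm (u::'a unitization) = max (cmod (scal u)) (onorm (lmult u))"
definition "sgn (u::'a unitization) = u /\<^sub>R norm u"
definition "dist (u::'a unitization) v = norm (u - v)"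
definition "uniformity = (INF e\<in>{0<..}. principal {(x::'a unitization, y). dist x y < e})"
definition "open (S::'a unitization set) \<longleftrightarrow> (\<forall>x\<in>S. \<forall>\<^sub>F (x', y) in uniformity. x' = x \<longrightarrow> y \<in> S)"

lemma norm_lmult_le: "norm (lmult u x) \<le> norm u * norm x" for u :: "'a unitization"
  by (rule order_trans[OF onorm[OF bounded_linear_lmult]])
    (simp add: norm_unitization_def mult_right_mono)

lemma norm_scal_le: "cmod (scal u) \<le> norm u" for u :: "'a unitization"
  by (simp add: norm_unitization_def)

lemma norm_unitization_le:
  fixes u :: "'a unitization"
  assumes "cmod (scal u) \<le> b" "\<And>x. norm (lmult u x) \<le> b * norm x"
  shows "norm u \<le> b"
  using assms onorm_bound[of b "lmult u"] unfolding norm_unitization_def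
  by (smt (verit) norm_ge_zero)

text \<open>Testing the operator on the adjoint of \<open>elt u\<close> recovers
  \<open>norm (elt u)\<close> by the C*-identity. This makes the norm definite and controls the
  second coordinate of a Cauchy sequence.\<close>

lemma norm_elt_le: "norm (elt u) \<le> norm u + cmod (scal u)" for u :: "'a unitization"
proof (cases "elt u = 0")
  case False
  have "norm (elt u) * norm (elt u) = norm (elt u * star (elt u))"
    using norm_star_mult_self[of "star (elt u)"] by simp
  also have "\<dots> = norm (lmult u (star (elt u)) - scal u *\<^sub>C star (elt u))"
    by (simp add: lmult_def)
  also have "\<dots> \<le> norm u * norm (elt u) + cmod (scal u) * norm (elt u)"
    using norm_triangle_ineq4[of "lmult u (star (elt u))" "scal u *\<^sub>C star (elt u)"]
      norm_lmult_le[of u "star (elt u)"] norm_scaleC[of "scal u" "star (elt u)"] by simp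
  finally have "norm (elt u) * norm (elt u) \<le> (norm u + cmod (scal u)) * norm (elt u)"
    by (simp add: algebra_simps)
  then show ?thesis using False by simp
qed (simp add: norm_unitization_def le_max_iff_disj)

instance
proof
  fix u v :: "'a unitization" and r :: real
  have nonneg: "0 \<le> norm w" for w :: "'a unitization"
    by (simp add: norm_unitization_def le_max_iff_disj)
  show "norm u = 0 \<longleftrightarrow> u = 0"
  proof
    assume "norm u = 0"
    then have "scal u = 0" using norm_scal_le[of u] by simp
    with \<open>norm u = 0\<close> have "elt u = 0" using norm_elt_le[of u] by simp
    with \<open>scal u = 0\<close> show "u = 0" by (simp add: unitization.expand)
  next
    assume "u = 0"
    then have "norm u \<le> 0" by (intro norm_unitization_le) (simp_all add: lmult_def)
    with nonneg show "norm u = 0" by (simp add: antisym)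
  qed
  show "norm (u + v) \<le> norm u + norm v"
  proof (rule norm_unitization_le)
    show "cmod (scal (u + v)) \<le> norm u + norm v"
      using norm_triangle_ineq[of "scal u" "scal v"] norm_scal_le[of u] norm_scal_le[of v] by simp
    have "lmult (u + v) x = lmult u x + lmult v x" for x
      by (simp add: lmult_def algebra_simps scaleC_add_left)
    then show "norm (lmult (u + v) x) \<le> (norm u + norm v) * norm x" for x
      using norm_triangle_ineq[of "lmult u x" "lmult v x"] norm_lmult_le[of u x] norm_lmult_le[of v x]
      by (simp add: algebra_simps)
  qed
  have *: "norm (r *\<^sub>R u) \<le> \<bar>r\<bar> * norm u" for r and u :: "'a unitization"
  proof (rule norm_unitization_le)
    show "cmod (scal (r *\<^sub>R u)) \<le> \<bar>r\<bar> * norm u"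
      using norm_scal_le[of u] by (simp add: mult_left_mono)
    have "lmult (r *\<^sub>R u) x = r *\<^sub>R lmult u x" for x
      by (simp add: lmult_def algebra_simps scaleR_scaleC scaleC_add_right scaleR_conv_of_real)
    then show "norm (lmult (r *\<^sub>R u) x) \<le> \<bar>r\<bar> * norm u * norm x" for x
      using norm_lmult_le[of u x] by (simp add: mult_left_mono mult.assoc)
  qed
  show "norm (r *\<^sub>R u) = \<bar>r\<bar> * norm u"
  proof (cases "r = 0")
    case False
    have "norm u \<le> \<bar>inverse r\<bar> * norm (r *\<^sub>R u)"
      using *[of "inverse r" "r *\<^sub>R u"] False by simp
    then have "\<bar>r\<bar> * norm u \<le> norm (r *\<^sub>R u)" using False by (simp add: field_simps)
    with *[of r u] show ?thesis by simp
  qed (use *[of 0 u] nonneg[of "0 *\<^sub>R u"] in simp)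
  show "norm (u * v) \<le> norm u * norm v"
  proof (rule norm_unitization_le)
    show "cmod (scal (u * v)) \<le> norm u * norm v"
      by (simp add: norm_mult mult_mono norm_scal_le nonneg)
    show "norm (lmult (u * v) x) \<le> norm u * norm v * norm x" for x
      using norm_lmult_le[of u "lmult v x"] norm_lmult_le[of v x] nonneg[of u]
      by (smt (verit) lmult_mult mult.assoc mult_left_mono)
  qed
  have "norm (1::'a unitization) \<le> 1"
    by (rule norm_unitization_le) (simp_all add: lmult_def)
  then show "norm (1::'a unitization) = 1"
    using norm_scal_le[of "1::'a unitization"] by simp
qed (simp_all only: sgn_unitization_def dist_unitization_def uniformity_unitization_def
      open_unitization_def)

end

instance unitization :: (nonunital_cstar_algebra) unital_cstar_algebra
proof
  fix c :: complex and u :: "'a unitization"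
  have *: "norm (c *\<^sub>C u) \<le> cmod c * norm u" for c and u :: "'a unitization"
  proof (rule norm_unitization_le)
    show "cmod (scal (c *\<^sub>C u)) \<le> cmod c * norm u"
      using norm_scal_le[of u] by (simp add: norm_mult mult_left_mono)
    have "lmult (c *\<^sub>C u) x = c *\<^sub>C lmult u x" for x
      by (simp add: lmult_def scaleC_add_right)
    then show "norm (lmult (c *\<^sub>C u) x) \<le> cmod c * norm u * norm x" for x
      using norm_lmult_le[of u x] by (simp add: norm_scaleC mult_left_mono mult.assoc)
  qed
  show "norm (c *\<^sub>C u) = cmod c * norm u"
  proof (cases "c = 0")
    case False
    have "norm u \<le> cmod (inverse c) * norm (c *\<^sub>C u)"
      using *[of "inverse c" "c *\<^sub>C u"] False by simp
    then have "cmod c * norm u \<le> norm (c *\<^sub>C u)" using False by (simp add: norm_inverse norm_divide field_simps)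
    with *[of c u] show ?thesis by simp
  qed simp
  \<comment> \<open>The operator norm is needed only for this half of the C*-identity. With
    submultiplicativity it makes the star isometric, and then the other half follows.\<close>
  have sq: "norm u * norm u \<le> norm (star u * u)" for u :: "'a unitization"
  proof -
    let ?n = "sqrt (norm (star u * u))"
    have "norm u \<le> ?n"
    proof (rule norm_unitization_le)
      show "cmod (scal u) \<le> ?n"
        using norm_scal_le[of "star u * u"]
        by (simp add: norm_mult real_le_rsqrt power2_eq_square)
      show "norm (lmult u x) \<le> ?n * norm x" for x
      proof -
        have "(norm (lmult u x))\<^sup>2 = norm (star (lmult u x) * lmult u x)"
          by (simp add: norm_star_mult_self power2_eq_square)
        also have "star (lmult u x) * lmult u x = star x * lmult (star u * u) x"
          by (simp add: lmult_def star_add star_scaleC star_mult scaleC_add_right algebra_simps)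
        also have "norm \<dots> \<le> norm x * (norm (star u * u) * norm x)"
          using norm_mult_ineq[of "star x" "lmult (star u * u) x"] norm_lmult_le[of "star u * u" x]
          by (smt (verit) mult_left_mono norm_ge_zero norm_star)
        also have "\<dots> = (?n * norm x)\<^sup>2" by (simp add: power2_eq_square)
        finally show ?thesis by (rule power2_le_imp_le) simp
      qed
    qed
    then have "norm u * norm u \<le> ?n * ?n" by (intro mult_mono) auto
    then show ?thesis by simp
  qed
  have ineq: "norm v \<le> norm (star v)" for v :: "'a unitization"
  proof (cases "v = 0")
    case False
    have "norm v * norm v \<le> norm (star v) * norm v"
      using sq[of v] norm_mult_ineq[of "star v" v] by simp
    then show ?thesis using False by simp
  qed simp
  have "norm (star u) = norm u" using ineq[of u] ineq[of "star u"] by simp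
  then show "norm (star u * u) = norm u * norm u"
    using sq[of u] norm_mult_ineq[of "star u" u] by simp
next
  fix X :: "nat \<Rightarrow> 'a unitization"
  assume X: "Cauchy X"
  have "norm (scal (X m) - scal (X n)) \<le> norm (X m - X n)" for m n
    using norm_scal_le[of "X m - X n"] by simp
  then have "Cauchy (\<lambda>n. scal (X n))"
    using X unfolding Cauchy_iff by (meson le_less_trans)
  then obtain s where s: "(\<lambda>n. scal (X n)) \<longlonglongrightarrow> s"
    using Cauchy_convergent convergent_def by blast
  have "norm (elt (X m) - elt (X n)) \<le> 2 * norm (X m - X n)" for m n
    using norm_elt_le[of "X m - X n"] norm_scal_le[of "X m - X n"] by simp
  moreover have "\<exists>M. \<forall>m\<ge>M. \<forall>n\<ge>M. 2 * norm (X m - X n) < e" if "e > 0" for e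
    using X that unfolding Cauchy_iff by (metis half_gt_zero less_divide_eq_numeral1(1) mult.commute)
  ultimately have "Cauchy (\<lambda>n. elt (X n))"
    unfolding Cauchy_iff by (meson le_less_trans)
  then obtain v where v: "(\<lambda>n. elt (X n)) \<longlonglongrightarrow> v"
    using Cauchy_convergent convergent_def by blast
  \<comment> \<open>Together with \<open>norm_elt_le\<close> this makes the norm equivalent to the
    sum of the norms of the coordinates, so completeness is inherited from both.\<close>
  have le: "norm u \<le> cmod (scal u) + norm (elt u)" for u :: "'a unitization"
  proof (rule norm_unitization_le)
    fix x
    have "norm (lmult u x) \<le> cmod (scal u) * norm x + norm (elt u * x)"
      unfolding lmult_def by (metis norm_scaleC norm_triangle_ineq)
    then show "norm (lmult u x) \<le> (cmod (scal u) + norm (elt u)) * norm x"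
      using norm_mult_ineq[of "elt u" x] by (simp add: algebra_simps)
  qed simp
  have "(\<lambda>n. cmod (scal (X n) - s) + norm (elt (X n) - v)) \<longlonglongrightarrow> 0 + 0"
    by (intro tendsto_add tendsto_norm_zero) (use s v in \<open>simp_all add: LIM_zero\<close>)
  then have "(\<lambda>n. cmod (scal (X n) - s) + norm (elt (X n) - v)) \<longlonglongrightarrow> 0" by simp
  from tendsto_sandwich[OF _ _ tendsto_const this]
  have "(\<lambda>n. norm (X n - Unitization s v)) \<longlonglongrightarrow> 0"
    using le[of "X _ - Unitization s v"] by (simp add: always_eventually)
  then have "X \<longlonglongrightarrow> Unitization s v" by (simp add: LIM_zero_iff tendsto_norm_zero_iff)
  then show "convergent X" by (rule convergentI)
qed


section \<open>Invertibility and spectrum\<close>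

definition invertible_elt :: "'a::monoid_mult \<Rightarrow> bool"
  where "invertible_elt x \<longleftrightarrow> (\<exists>y. x * y = 1 \<and> y * x = 1)"

definition spectrum :: "'a::{complex_algebra, ring_1} \<Rightarrow> complex set"
  where "spectrum x = {z. \<not> invertible_elt (x - z *\<^sub>C 1)}"

lemma invertible_elt_mult: "invertible_elt x \<Longrightarrow> invertible_elt y \<Longrightarrow> invertible_elt (x * y)"
  unfolding invertible_elt_def by (metis mult.assoc mult_1_left)

lemma invertible_elt_scaleC:
  fixes x :: "'a::{complex_algebra, ring_1}"
  assumes "invertible_elt x" "c \<noteq> 0"
  shows "invertible_elt (c *\<^sub>C x)"
proof -
  obtain y where "x * y = 1" "y * x = 1" using assms(1) unfolding invertible_elt_def by blast
  then show ?thesis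
    unfolding invertible_elt_def using assms(2) by (intro exI[of _ "inverse c *\<^sub>C y"]) simp
qed

text \<open>The inverse is the Neumann series.\<close>

lemma invertible_elt_one_minus:
  fixes x :: "'a::{real_normed_algebra_1, banach}"
  assumes "norm x < 1"
  shows "invertible_elt (1 - x)"
proof -
  have s: "summable (\<lambda>n. x ^ n)" by (rule complete_algebra_summable_geometric[OF assms])
  let ?S = "\<Sum>n. x ^ n"
  have "(\<Sum>n. x ^ Suc n) = ?S - 1" using suminf_split_head[OF s] by simp
  moreover have "(\<Sum>n. x ^ Suc n) = x * ?S" using suminf_mult[OF s, of x] by simp
  moreover have "(\<Sum>n. x ^ Suc n) = ?S * x"
    using suminf_mult2[OF s, of x] by (simp add: power_commutes)
  ultimately show ?thesis
    unfolding invertible_elt_def by (intro exI[of _ ?S]) (simp add: algebra_simps)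
qed

lemma spectrum_bounded:
  fixes x :: "'a::unital_cstar_algebra"
  assumes "z \<in> spectrum x"
  shows "cmod z \<le> norm x"
proof (rule ccontr)
  assume *: "\<not> cmod z \<le> norm x"
  then have "z \<noteq> 0" by auto
  have "norm (inverse z *\<^sub>C x) < 1"
    using * \<open>z \<noteq> 0\<close> by (simp add: norm_scaleC norm_inverse norm_divide field_simps)
  then have "invertible_elt ((- z) *\<^sub>C (1 - inverse z *\<^sub>C x))"
    using \<open>z \<noteq> 0\<close> by (intro invertible_elt_scaleC invertible_elt_one_minus) auto
  also have "(- z) *\<^sub>C (1 - inverse z *\<^sub>C x) = x - z *\<^sub>C 1"
    using \<open>z \<noteq> 0\<close> by (simp add: scaleC_diff_right)
  finally show False using assms by (simp add: spectrum_def)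
qed

text \<open>If \<open>y\<close> is the inverse of \<open>x - z\<close>, then
  \<open>x - w = (x - z) (1 - (w - z) y)\<close>, so the disc of radius \<open>1 / norm y\<close>
  about \<open>z\<close> misses the spectrum.\<close>

lemma compact_spectrum: "compact (spectrum (x::'a::unital_cstar_algebra))"
proof -
  have "open (- spectrum x)"
    unfolding open_contains_ball
  proof safe
    fix z assume "z \<notin> spectrum x"
    then obtain y where y: "(x - z *\<^sub>C 1) * y = 1" "y * (x - z *\<^sub>C 1) = 1"
      by (auto simp: spectrum_def invertible_elt_def)
    have "y \<noteq> 0" using y by auto
    show "\<exists>e>0. ball z e \<subseteq> - spectrum x"
    proof (intro exI conjI subsetI)
      show "0 < inverse (norm y)" using \<open>y \<noteq> 0\<close> by simp
      fix w assume "w \<in> ball z (inverse (norm y))"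
      then have "norm ((w - z) *\<^sub>C y) < 1"
        using \<open>y \<noteq> 0\<close> by (simp add: norm_scaleC dist_norm field_simps norm_minus_commute)
      then have "invertible_elt ((x - z *\<^sub>C 1) * (1 - (w - z) *\<^sub>C y))"
        using y by (intro invertible_elt_mult invertible_elt_one_minus) (auto simp: invertible_elt_def)
      also have "(x - z *\<^sub>C 1) * (1 - (w - z) *\<^sub>C y) = x - w *\<^sub>C 1"
        using y(1) by (simp add: right_diff_distrib scaleC_diff_left)
      finally show "w \<in> - spectrum x" by (simp add: spectrum_def)
    qed
  qed
  then have "closed (spectrum x)" by (simp add: closed_def)
  moreover have "bounded (spectrum x)"
    using spectrum_bounded by (auto simp: bounded_iff)
  ultimately show ?thesis by (simp add: compact_eq_bounded_closed)
qed

section \<open>Commutative subalgebras and their quotients\<close>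

text \<open>The last assumption makes invertibility in \<open>B\<close> the same as in the ambient
  algebra. Hence \<open>spectrum\<close>, defined in the ambient algebra, can be computed with
  ideals and characters of \<open>B\<close>.\<close>

locale commutative_cstar_subalgebra =
  fixes B :: "'a::unital_cstar_algebra set"
  assumes closed: "closed B"
    and one [simp, intro]: "1 \<in> B"
    and add [simp, intro]: "x \<in> B \<Longrightarrow> y \<in> B \<Longrightarrow> x + y \<in> B"
    and mult [simp, intro]: "x \<in> B \<Longrightarrow> y \<in> B \<Longrightarrow> x * y \<in> B"
    and scaleC [simp, intro]: "x \<in> B \<Longrightarrow> c *\<^sub>C x \<in> B"
    and star [simp, intro]: "x \<in> B \<Longrightarrow> star x \<in> B"
    and commute: "x \<in> B \<Longrightarrow> y \<in> B \<Longrightarrow> x * y = y * x"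
    and inverse: "x \<in> B \<Longrightarrow> x * y = 1 \<Longrightarrow> y * x = 1 \<Longrightarrow> y \<in> B"
begin

lemma zero [simp, intro]: "0 \<in> B"
  using scaleC[of 1 0] by simp

lemma minus [simp, intro]: "x \<in> B \<Longrightarrow> - x \<in> B"
  using scaleC[of x "- 1"] by simp

lemma diff [simp, intro]: "x \<in> B \<Longrightarrow> y \<in> B \<Longrightarrow> x - y \<in> B"
  using add[of x "- y"] by simp

lemma power [simp, intro]: "x \<in> B \<Longrightarrow> x ^ n \<in> B"
  by (induction n) auto

lemma sum [intro]: "(\<And>i. i \<in> I \<Longrightarrow> f i \<in> B) \<Longrightarrow> (\<Sum>i\<in>I. f i) \<in> B"
  by (induction I rule: infinite_finite_induct) auto

lemma left_commute: "x \<in> B \<Longrightarrow> y \<in> B \<Longrightarrow> x * (y * z) = y * (x * z)"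
  by (metis commute mult.assoc)

text \<open>Closure under scalars comes from multiplying by the elements
  \<open>c *\<^sub>C 1\<close> of \<open>B\<close>, and left multiplication from
  commutativity.\<close>

definition proper_ideal :: "'a set \<Rightarrow> bool" where
  "proper_ideal M \<longleftrightarrow> M \<subseteq> B \<and> 0 \<in> M \<and> 1 \<notin> M \<and>
    (\<forall>x\<in>M. \<forall>y\<in>M. x + y \<in> M) \<and> (\<forall>x\<in>M. \<forall>y\<in>B. x * y \<in> M)"

end

locale closed_proper_ideal = commutative_cstar_subalgebra +
  fixes M :: "'a set"
  assumes ideal: "proper_ideal M" and closed_ideal: "closed M"
begin

lemma ideal_subset: "x \<in> M \<Longrightarrow> x \<in> B"
  and ideal_zero [simp]: "0 \<in> M"
  and ideal_one: "1 \<notin> M"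
  and ideal_add: "x \<in> M \<Longrightarrow> y \<in> M \<Longrightarrow> x + y \<in> M"
  and ideal_mult: "x \<in> M \<Longrightarrow> y \<in> B \<Longrightarrow> x * y \<in> M"
  using ideal by (auto simp: proper_ideal_def)

lemma ideal_mult_left: "x \<in> M \<Longrightarrow> y \<in> B \<Longrightarrow> y * x \<in> M"
  using ideal_mult[of x y] commute[of x y] ideal_subset by simp

lemma ideal_scaleC: "x \<in> M \<Longrightarrow> c *\<^sub>C x \<in> M"
  using ideal_mult[of x "c *\<^sub>C 1"] by simp

lemma ideal_minus: "x \<in> M \<Longrightarrow> - x \<in> M"
  using ideal_scaleC[of x "- 1"] by simp

lemma ideal_diff: "x \<in> M \<Longrightarrow> y \<in> M \<Longrightarrow> x - y \<in> M"
  using ideal_add[of x "- y"] ideal_minus[of y] by simp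

lemma ideal_sum: "(\<And>i. i \<in> I \<Longrightarrow> f i \<in> M) \<Longrightarrow> (\<Sum>i\<in>I. f i) \<in> M"
  by (induction I rule: infinite_finite_induct) (auto intro: ideal_add)

text \<open>The norm of the class of \<open>x\<close> in the quotient by \<open>M\<close>.\<close>

definition qnorm :: "'a \<Rightarrow> real" where "qnorm x = infdist x M"

lemma qnorm_nonneg [simp]: "0 \<le> qnorm x"
  by (simp add: qnorm_def infdist_nonneg)

lemma qnorm_le: "m \<in> M \<Longrightarrow> qnorm x \<le> norm (x - m)"
  unfolding qnorm_def by (metis infdist_le dist_norm)

lemma qnorm_approx: "e > 0 \<Longrightarrow> \<exists>m\<in>M. norm (x - m) < qnorm x + e"
proof (rule ccontr)
  assume e: "e > 0" and *: "\<not> (\<exists>m\<in>M. norm (x - m) < qnorm x + e)"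
  have "M \<noteq> {}" using ideal_zero by blast
  then have "qnorm x + e \<le> infdist x M"
    unfolding infdist_notempty[OF \<open>M \<noteq> {}\<close>]
    by (intro cINF_greatest) (use * in \<open>auto simp: dist_norm not_less\<close>)
  then show False using e by (simp add: qnorm_def)
qed

lemma qnorm_eq_0_iff: "qnorm x = 0 \<longleftrightarrow> x \<in> M"
  unfolding qnorm_def using in_closed_iff_infdist_zero[OF closed_ideal, of x] ideal_zero by blast

lemma qnorm_zero [simp]: "qnorm 0 = 0"
  by (simp add: qnorm_eq_0_iff)

lemma qnorm_triangle: "qnorm (x + y) \<le> qnorm x + qnorm y"
proof (rule field_le_epsilon)
  fix e :: real assume "e > 0"
  then obtain m n where m: "m \<in> M" "norm (x - m) < qnorm x + e / 2"
    and n: "n \<in> M" "norm (y - n) < qnorm y + e / 2"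
    using qnorm_approx[of "e / 2"] by (meson half_gt_zero)
  have "qnorm (x + y) \<le> norm ((x - m) + (y - n))"
    using qnorm_le[OF ideal_add[OF m(1) n(1)], of "x + y"] by (simp add: algebra_simps)
  also have "\<dots> \<le> norm (x - m) + norm (y - n)" by (rule norm_triangle_ineq)
  finally show "qnorm (x + y) \<le> qnorm x + qnorm y + e" using m n by simp
qed

lemma qnorm_cong: "x - y \<in> M \<Longrightarrow> qnorm x = qnorm y"
proof -
  assume *: "x - y \<in> M"
  then have "qnorm (x - y) = 0" "qnorm (y - x) = 0"
    using ideal_minus[OF *] by (simp_all add: qnorm_eq_0_iff)
  then show ?thesis
    using qnorm_triangle[of "x - y" y] qnorm_triangle[of "y - x" x] by simp
qed

lemma qnorm_scaleC: "qnorm (c *\<^sub>C x) = cmod c * qnorm x"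
proof -
  have le: "qnorm (c *\<^sub>C x) \<le> cmod c * qnorm x" for c x
  proof (cases "c = 0")
    case False
    show ?thesis
    proof (rule field_le_epsilon)
      fix e :: real assume "e > 0"
      then obtain m where m: "m \<in> M" "norm (x - m) < qnorm x + e / cmod c"
        using qnorm_approx[of "e / cmod c"] False by auto
      have "qnorm (c *\<^sub>C x) \<le> norm (c *\<^sub>C (x - m))"
        using qnorm_le[OF ideal_scaleC[OF m(1)]] by (simp add: scaleC_diff_right)
      also have "\<dots> \<le> cmod c * (qnorm x + e / cmod c)"
        using m by (simp add: norm_scaleC mult_left_mono)
      finally show "qnorm (c *\<^sub>C x) \<le> cmod c * qnorm x + e"
        using False by (simp add: algebra_simps)
    qed
  qed simp
  show ?thesis
  proof (cases "c = 0")
    case False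
    then have "qnorm x \<le> cmod (1 / c) * qnorm (c *\<^sub>C x)"
      using le[of "1 / c" "c *\<^sub>C x"] by simp
    then show ?thesis using le[of c x] False by (simp add: norm_divide field_simps)
  qed simp
qed

lemma qnorm_minus: "qnorm (- x) = qnorm x"
  using qnorm_scaleC[of "- 1" x] by simp

lemma qnorm_diff_commute: "qnorm (x - y) = qnorm (y - x)"
  using qnorm_minus[of "x - y"] by simp

lemma qnorm_sum_le: "qnorm (\<Sum>i\<in>I. f i) \<le> (\<Sum>i\<in>I. qnorm (f i))"
proof (induction I rule: infinite_finite_induct)
  case (insert i I)
  then show ?case using qnorm_triangle[of "f i" "sum f I"] by simp
qed simp_all

text \<open>The product \<open>(x - m) (y - n)\<close> differs from \<open>x y\<close> by an element
  of the ideal. The infima defining the two factors are only approached, hence the passage to the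
  limit in \<open>e\<close>.\<close>

lemma qnorm_mult:
  assumes "x \<in> B" "y \<in> B"
  shows "qnorm (x * y) \<le> qnorm x * qnorm y"
proof -
  have *: "qnorm (x * y) \<le> norm (x - m) * norm (y - n)" if "m \<in> M" "n \<in> M" for m n
  proof -
    have "m * (y - n) + x * n \<in> M"
      using that assms by (intro ideal_add ideal_mult ideal_mult_left) (auto dest: ideal_subset)
    from qnorm_le[OF this, of "x * y"] have "qnorm (x * y) \<le> norm ((x - m) * (y - n))"
      by (simp add: algebra_simps)
    then show ?thesis using norm_mult_ineq[of "x - m" "y - n"] by simp
  qed
  have lim: "((\<lambda>e. (qnorm x + e) * (qnorm y + e)) \<longlongrightarrow> (qnorm x + 0) * (qnorm y + 0)) (at_right 0)"
    by (intro tendsto_intros)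
  have "\<forall>\<^sub>F e in at_right 0. qnorm (x * y) \<le> (qnorm x + e) * (qnorm y + e)"
    unfolding eventually_at_right_field
  proof (intro exI[of _ 1] conjI allI impI)
    fix e :: real assume "e > 0"
    then obtain m n where m: "m \<in> M" "norm (x - m) < qnorm x + e"
      and n: "n \<in> M" "norm (y - n) < qnorm y + e"
      using qnorm_approx by meson
    have "norm (x - m) * norm (y - n) \<le> (qnorm x + e) * (qnorm y + e)"
      using m n \<open>e > 0\<close> by (intro mult_mono) (auto intro: add_nonneg_nonneg)
    then show "qnorm (x * y) \<le> (qnorm x + e) * (qnorm y + e)" using *[OF m(1) n(1)] by simp
  qed simp
  from tendsto_lowerbound[OF lim this] show ?thesis by simp
qed

lemma qnorm_one_pos: "0 < qnorm 1"
  using qnorm_eq_0_iff[of 1] ideal_one qnorm_nonneg[of 1] by linarith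

end


section \<open>The spectral radius modulo an ideal\<close>

text \<open>A connectedness argument on [0, 1]. Let \<open>S\<close> be the set of radii
  \<open>r\<close> for which \<open>r^n p n\<close> tends to 0. Since \<open>K\<close> does not
  depend on the radius, \<open>step\<close> reaches the supremum of \<open>S\<close> from a nearby
  member, so the supremum belongs to \<open>S\<close>; and if it were below 1, \<open>step\<close>
  would carry it further.\<close>

lemma null_sequence_of_weighted_steps:
  fixes p :: "nat \<Rightarrow> real"
  assumes nonneg: "\<And>n. 0 \<le> p n" and "K > 0"
    and step: "\<And>r s e. \<lbrakk>0 \<le> r; r \<le> s; s \<le> 1; 0 < e; e \<le> 1/4; K * (s - r) \<le> e;
      (\<lambda>n. r ^ n * p n) \<longlonglongrightarrow> 0\<rbrakk> \<Longrightarrow> \<forall>\<^sub>F n in sequentially. s ^ n * p n \<le> 4 * e"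
  shows "p \<longlonglongrightarrow> 0"
proof -
  define S where "S = {r. 0 \<le> r \<and> r \<le> 1 \<and> (\<lambda>n. r ^ n * p n) \<longlonglongrightarrow> 0}"
  \<comment> \<open>As \<open>0 ^ 0 = 1\<close>, the term at \<open>n = 0\<close> may be nonzero;
    all others vanish.\<close>
  have "(\<lambda>n. 0 ^ n * p n) \<longlonglongrightarrow> 0"
    by (rule tendsto_eventually) (auto simp: eventually_sequentially power_0_left intro: exI[of _ 1])
  then have "0 \<in> S" by (simp add: S_def)
  have bdd: "bdd_above S" by (auto simp: S_def bdd_above_def)
  define s where "s = Sup S"
  have s: "0 \<le> s" "s \<le> 1"
    unfolding s_def using \<open>0 \<in> S\<close> bdd by (auto intro: cSup_upper cSup_least simp: S_def)
  have near: "\<exists>r\<in>S. K * (s - r) \<le> e" if "e > 0" for e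
  proof -
    have "s - e / K < Sup S" using that \<open>K > 0\<close> by (simp add: s_def)
    then obtain r where "r \<in> S" "s - e / K < r"
      using less_cSup_iff[of S] \<open>0 \<in> S\<close> bdd by blast
    then show ?thesis using \<open>K > 0\<close> by (intro bexI[of _ r]) (auto simp: field_simps)
  qed
  have s_null: "(\<lambda>n. s ^ n * p n) \<longlonglongrightarrow> 0"
  proof (rule LIMSEQ_I)
    fix e :: real assume "e > 0"
    define e' where "e' = min (1/4) (e / 8)"
    have "e' > 0" "e' \<le> 1/4" "4 * e' < e" using \<open>e > 0\<close> by (auto simp: e'_def)
    obtain r where "r \<in> S" "K * (s - r) \<le> e'" using near[OF \<open>e' > 0\<close>] by blast
    moreover have "r \<le> s" unfolding s_def using \<open>r \<in> S\<close> bdd by (rule cSup_upper)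
    ultimately have "\<forall>\<^sub>F n in sequentially. s ^ n * p n \<le> 4 * e'"
      using s \<open>e' > 0\<close> \<open>e' \<le> 1/4\<close> by (intro step[of r s e']) (auto simp: S_def)
    then show "\<exists>no. \<forall>n\<ge>no. norm (s ^ n * p n - 0) < e"
      using \<open>4 * e' < e\<close> nonneg s unfolding eventually_sequentially by (fastforce simp: abs_mult)
  qed
  have "s = 1"
  proof (rule ccontr)
    assume "s \<noteq> 1"
    \<comment> \<open>The farthest point that \<open>step\<close> reaches with
      \<open>e = 1/4\<close>, the largest value allowed; the bound \<open>4 * e\<close> is then
      1.\<close>
    define t where "t = min 1 (s + 1 / (4 * K))"
    have t: "s < t" "t \<le> 1" "K * (t - s) \<le> 1/4"
      using \<open>s \<noteq> 1\<close> s \<open>K > 0\<close> by (auto simp: t_def min_def field_simps)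
    have ev: "\<forall>\<^sub>F n in sequentially. t ^ n * p n \<le> 4 * (1/4)"
      using s t s_null by (intro step[of s]) auto
    \<comment> \<open>At \<open>t\<close> the sequence is only bounded; any smaller radius gains the
      factor \<open>(u / t) ^ n\<close>, which tends to 0.\<close>
    define u where "u = (s + t) / 2"
    have u: "s < u" "u < t" "0 \<le> u" using s t by (auto simp: u_def)
    have "(\<lambda>n. u ^ n * p n) \<longlonglongrightarrow> 0"
    proof (rule tendsto_sandwich)
      show "\<forall>\<^sub>F n in sequentially. 0 \<le> u ^ n * p n" using nonneg u by simp
      show "\<forall>\<^sub>F n in sequentially. u ^ n * p n \<le> (u / t) ^ n"
        using ev
      proof eventually_elim
        case (elim n)
        then have "(u / t) ^ n * (t ^ n * p n) \<le> (u / t) ^ n * 1"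
          using u by (intro mult_left_mono) auto
        then show ?case using u by (simp add: power_divide)
      qed
      show "(\<lambda>n. (u / t) ^ n) \<longlonglongrightarrow> 0" using u by (intro LIMSEQ_power_zero) auto
    qed simp
    then have "u \<in> S" using u t by (simp add: S_def)
    then have "u \<le> s" unfolding s_def using bdd by (rule cSup_upper)
    with u show False by simp
  qed
  with s_null show ?thesis by simp
qed

text \<open>For \<open>0 < k < n\<close> the power \<open>\<omega> ^ k\<close> is an
  \<open>n\<close>-th root of unity other than 1, so the geometric sum has numerator 0.\<close>

lemma root_of_unity_orthogonality:
  assumes "n > 0"
  obtains \<omega> :: complex where "\<omega> ^ n = 1" "cmod \<omega> = 1"
    "\<And>k. k < n \<Longrightarrow> (\<Sum>j<n. (\<omega> ^ j) ^ k) = (if k = 0 then of_nat n else 0)"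
proof
  define \<omega> where "\<omega> = cis (2 * pi / n)"
  show 1: "\<omega> ^ n = 1" using assms by (simp add: \<omega>_def Complex.DeMoivre)
  show "cmod \<omega> = 1" by (simp add: \<omega>_def)
  show "(\<Sum>j<n. (\<omega> ^ j) ^ k) = (if k = 0 then of_nat n else 0)" if "k < n" for k
  proof (cases "k = 0")
    case False
    have "\<omega> ^ k = exp (2 * of_real pi * \<i> * of_nat k / of_nat n)"
      unfolding \<omega>_def Complex.DeMoivre by (simp add: cis_conv_exp mult_ac)
    moreover have "\<not> n dvd k" using False that by (simp add: nat_dvd_not_less)
    ultimately have "\<omega> ^ k \<noteq> 1" using complex_root_unity_eq_1[of n k] assms by simp
    have "(\<Sum>j<n. (\<omega> ^ j) ^ k) = (\<Sum>j<n. (\<omega> ^ k) ^ j)"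
      by (simp add: power_mult[symmetric] mult.commute)
    also have "\<dots> = ((\<omega> ^ k) ^ n - 1) / (\<omega> ^ k - 1)" by (rule geometric_sum[OF \<open>\<omega> ^ k \<noteq> 1\<close>])
    also have "(\<omega> ^ k) ^ n = 1" using 1 by (metis power_mult mult.commute power_one)
    finally show ?thesis using False by simp
  qed simp
qed

lemma power_scaleC: "(c *\<^sub>C x) ^ n = c ^ n *\<^sub>C x ^ n" for x :: "'a::unital_cstar_algebra"
  by (induction n) (simp_all add: mult.commute[of c])

lemma geometric_sum_one_minus: "(\<Sum>k<n. x ^ k) * (1 - x) = 1 - x ^ n" for x :: "'a::ring_1"
proof (induction n)
  case (Suc n)
  then show ?case
    by (simp only: sum.lessThan_Suc distrib_right power_Suc2) (simp add: right_diff_distrib)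
qed simp

context closed_proper_ideal
begin

lemma qnorm_diff_le: "qnorm (x - y) \<le> qnorm x + qnorm y"
  using qnorm_triangle[of x "- y"] by (simp add: qnorm_minus)

text \<open>
  With \<open>F z\<close> an inverse of \<open>1 - z x\<close> modulo \<open>M\<close>, the mean \<open>G t\<close> of \<open>F\<close> over the points \<open>\<omega>\<^sup>j t\<close>, where
  \<open>\<omega>\<close> is a primitive \<open>n\<close>-th root of unity, is an inverse of \<open>1 - t\<^sup>n x\<^sup>n\<close>. Hence \<open>r\<^sup>n x\<^sup>n\<close> is small
  if and only if \<open>G r\<close> is close to \<open>1\<close>, and since \<open>F\<close> is Lipschitz this passes from \<open>r\<close> to nearby
  \<open>s\<close>, uniformly in \<open>n\<close>.
\<close>

proposition qnorm_power_tendsto_zero: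
  assumes x: "x \<in> B"
    and inv: "\<And>z. cmod z \<le> 1 \<Longrightarrow> \<exists>y\<in>B. 1 - (1 - z *\<^sub>C x) * y \<in> M"
  shows "(\<lambda>n. qnorm (x ^ n)) \<longlonglongrightarrow> 0"
proof -
  define D where "D = cball (0::complex) 1"
  obtain F where F_in: "\<And>z. z \<in> D \<Longrightarrow> F z \<in> B"
    and F: "\<And>z. z \<in> D \<Longrightarrow> 1 - (1 - z *\<^sub>C x) * F z \<in> M"
    using inv unfolding D_def by (simp add: dist_norm) metis
  have F_diff: "qnorm (F z - F w) \<le> cmod (z - w) * (qnorm x * (qnorm (F z) * qnorm (F w)))"
    if "z \<in> D" "w \<in> D" for z w
  proof -
    note [simp] = F_in[OF that(1)] F_in[OF that(2)] x
    \<comment> \<open>Resolvent identity modulo \<open>M\<close>: the products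
      \<open>F z * F w\<close> cancel, leaving the difference of the inverses and a term with the
      factor \<open>z - w\<close>.\<close>
    have "F z * (1 - (1 - w *\<^sub>C x) * F w) - F w * (1 - (1 - z *\<^sub>C x) * F z) \<in> M"
      using that by (intro ideal_diff ideal_mult_left F) auto
    also have "F z * (1 - (1 - w *\<^sub>C x) * F w) - F w * (1 - (1 - z *\<^sub>C x) * F z)
      = (F z - F w) - (z - w) *\<^sub>C (x * (F z * F w))"
      by (simp add: algebra_simps scaleC_diff_left commute[of "F w" "F z"] left_commute[of "F z" x]
          left_commute[of "F w" x])
    finally have "qnorm (F z - F w) = cmod (z - w) * qnorm (x * (F z * F w))"
      by (metis qnorm_cong qnorm_scaleC)
    also have "qnorm (x * (F z * F w)) \<le> qnorm x * (qnorm (F z) * qnorm (F w))"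
      using qnorm_mult[of x "F z * F w"] qnorm_mult[of "F z" "F w"]
      by (simp add: order_trans[OF _ mult_left_mono])
    finally show ?thesis by (simp add: mult_left_mono)
  qed
  have F_pos: "0 < qnorm (F z)" if "z \<in> D" for z
  proof (rule ccontr)
    assume "\<not> 0 < qnorm (F z)"
    then have "F z \<in> M" using qnorm_nonneg[of "F z"] qnorm_eq_0_iff[of "F z"] by linarith
    then have "(1 - z *\<^sub>C x) * F z \<in> M" using x by (intro ideal_mult_left) auto
    from ideal_add[OF F[OF that] this] show False using ideal_one by simp
  qed
  \<comment> \<open>The reciprocal of \<open>qnorm (F z)\<close> is Lipschitz by \<open>F_diff\<close>, so it has a positive minimum on the disc.\<close>
  obtain C where "C > 0" and C: "\<And>z. z \<in> D \<Longrightarrow> qnorm (F z) \<le> C"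
  proof -
    define g where "g z = 1 / qnorm (F z)" for z
    have "\<bar>g z - g w\<bar> \<le> qnorm x * cmod (z - w)" if "z \<in> D" "w \<in> D" for z w
    proof -
      have "\<bar>qnorm (F w) - qnorm (F z)\<bar> \<le> qnorm (F z - F w)"
        using qnorm_triangle[of "F z - F w" "F w"] qnorm_triangle[of "F w - F z" "F z"]
          qnorm_diff_commute[of "F z" "F w"] by simp
      also have "\<dots> \<le> qnorm x * cmod (z - w) * (qnorm (F z) * qnorm (F w))"
        using F_diff[OF that] by (simp add: mult_ac)
      finally have "\<bar>qnorm (F w) - qnorm (F z)\<bar> / (qnorm (F z) * qnorm (F w)) \<le> qnorm x * cmod (z - w)"
        using F_pos[OF that(1)] F_pos[OF that(2)] by (simp add: pos_divide_le_eq)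
      moreover have "g z - g w = (qnorm (F w) - qnorm (F z)) / (qnorm (F z) * qnorm (F w))"
        using F_pos[OF that(1)] F_pos[OF that(2)] by (simp add: g_def field_simps)
      ultimately show ?thesis
        using F_pos[OF that(1)] F_pos[OF that(2)] by (simp add: abs_mult)
    qed
    then have "(qnorm x)-lipschitz_on D g"
      by (intro lipschitz_onI) (auto simp: dist_norm)
    then have "continuous_on D g" by (rule lipschitz_on_continuous_on)
    moreover have "compact D" "D \<noteq> {}" by (auto simp: D_def)
    ultimately obtain z0 where z0: "z0 \<in> D" "\<And>z. z \<in> D \<Longrightarrow> g z0 \<le> g z"
      using continuous_attains_inf by metis
    show ?thesis
    proof
      show "0 < qnorm (F z0)" by (rule F_pos[OF z0(1)])
      show "qnorm (F z) \<le> qnorm (F z0)" if "z \<in> D" for z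
        using z0(2)[OF that] F_pos[OF that] F_pos[OF z0(1)] by (simp add: g_def field_simps)
    qed
  qed
  \<comment> \<open>The summand 1 keeps \<open>K\<close> positive when
    \<open>qnorm x = 0\<close>.\<close>
  define K where "K = qnorm x * (C * C) + 1"
  have "K > 0" using \<open>C > 0\<close> by (simp add: K_def add_nonneg_pos)
  have F_lip: "qnorm (F z - F w) \<le> K * cmod (z - w)" if "z \<in> D" "w \<in> D" for z w
  proof -
    have "qnorm x * (qnorm (F z) * qnorm (F w)) \<le> K"
      unfolding K_def using C[OF that(1)] C[OF that(2)] \<open>C > 0\<close>
      by (intro add_increasing2 mult_left_mono mult_mono) auto
    from mult_left_mono[OF this, of "cmod (z - w)"] F_diff[OF that]
    show ?thesis by (simp add: mult.commute)
  qed
  show ?thesis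
  proof (rule null_sequence_of_weighted_steps[OF qnorm_nonneg \<open>K > 0\<close>])
    fix r s e :: real
    assume rs: "0 \<le> r" "r \<le> s" "s \<le> 1" and e: "0 < e" "e \<le> 1/4" "K * (s - r) \<le> e"
      and lim: "(\<lambda>n. r ^ n * qnorm (x ^ n)) \<longlonglongrightarrow> 0"
    have "\<forall>\<^sub>F n in sequentially. r ^ n * qnorm (x ^ n) < e / C"
      using order_tendstoD(2)[OF lim] e(1) \<open>C > 0\<close> by simp
    then show "\<forall>\<^sub>F n in sequentially. s ^ n * qnorm (x ^ n) \<le> 4 * e"
      using eventually_gt_at_top[of 0]
    proof eventually_elim
      case (elim n)
      obtain \<omega> :: complex where \<omega>: "\<omega> ^ n = 1" "cmod \<omega> = 1"
        "\<And>k. k < n \<Longrightarrow> (\<Sum>j<n. (\<omega> ^ j) ^ k) = (if k = 0 then of_nat n else 0)"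
        using root_of_unity_orthogonality[OF elim(2)] by blast
      define pt where "pt t j = \<omega> ^ j * complex_of_real t" for t j
      have pt_D: "pt t j \<in> D" if "0 \<le> t" "t \<le> 1" for t j
        using that \<omega>(2) by (simp add: pt_def D_def dist_norm norm_mult norm_power)
      define G where "G t = (1 / of_nat n) *\<^sub>C (\<Sum>j<n. F (pt t j))" for t
      define u where "u t = complex_of_real (t ^ n) *\<^sub>C x ^ n" for t
      have qnorm_u: "qnorm (u t) = t ^ n * qnorm (x ^ n)" if "0 \<le> t" for t
        unfolding u_def using that by (simp add: qnorm_scaleC norm_power)
      have G_in: "G t \<in> B" if "0 \<le> t" "t \<le> 1" for t
        unfolding G_def using that by (intro scaleC sum F_in pt_D)
      have u_in: "u t \<in> B" for t unfolding u_def using x by auto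
      have G: "1 - (1 - u t) * G t \<in> M" if t: "0 \<le> t" "t \<le> 1" for t
      proof -
        \<comment> \<open>A truncated Neumann series. As \<open>pt t j\<close> has
          \<open>n\<close>-th power \<open>t ^ n\<close> for every \<open>j\<close>, multiplying
          \<open>S j\<close> by \<open>1 - pt t j *\<^sub>C x\<close> always gives
          \<open>1 - u t\<close>; so \<open>S j\<close> agrees with
          \<open>(1 - u t) * F (pt t j)\<close> modulo \<open>M\<close>. In the mean over
          \<open>j\<close> only the power \<open>k = 0\<close> survives, which leaves 1.\<close>
        define S where "S j = (\<Sum>k<n. (pt t j *\<^sub>C x) ^ k)" for j
        have *: "S j - (1 - u t) * F (pt t j) \<in> M" for j
        proof -
          have "pt t j ^ n = complex_of_real (t ^ n)"
            using \<omega>(1) by (simp add: pt_def power_mult_distrib flip: power_mult) (simp add: power_mult mult.commute[of j])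
          then have "S j * (1 - pt t j *\<^sub>C x) = 1 - u t"
            unfolding S_def geometric_sum_one_minus by (simp add: power_scaleC u_def)
          then have "S j - (1 - u t) * F (pt t j) = S j * (1 - (1 - pt t j *\<^sub>C x) * F (pt t j))"
            by (simp add: right_diff_distrib mult.assoc[symmetric])
          also have "\<dots> \<in> M"
            using x t by (intro ideal_mult_left F pt_D) (auto simp: S_def)
          finally show ?thesis .
        qed
        have "(\<Sum>j<n. S j) = (\<Sum>k<n. (\<Sum>j<n. (\<omega> ^ j) ^ k) *\<^sub>C (complex_of_real (t ^ k) *\<^sub>C x ^ k))"
          unfolding S_def by (subst sum.swap)
            (simp add: scaleC_sum_left power_scaleC pt_def power_mult_distrib sum_distrib_right)
        also have "\<dots> = (\<Sum>k<n. if k = 0 then of_nat n *\<^sub>C 1 else 0)"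
          by (intro sum.cong refl) (simp add: \<omega>(3))
        also have "\<dots> = of_nat n *\<^sub>C 1" using elim(2) by (simp add: sum.delta)
        finally have sum_S: "(\<Sum>j<n. S j) = of_nat n *\<^sub>C 1" .
        have "(1 / of_nat n) *\<^sub>C (\<Sum>j<n. S j - (1 - u t) * F (pt t j)) \<in> M"
          by (intro ideal_scaleC ideal_sum *)
        also have "(1 / of_nat n) *\<^sub>C (\<Sum>j<n. S j - (1 - u t) * F (pt t j)) = 1 - (1 - u t) * G t"
          using elim(2) by (simp add: G_def sum_subtractf sum_S scaleC_diff_right sum_distrib_left[symmetric])
        finally show ?thesis .
      qed
      have avg: "qnorm ((1 / of_nat n) *\<^sub>C (\<Sum>j<n. f j)) \<le> b" if "\<And>j. qnorm (f j) \<le> b" for f b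
      proof -
        have "qnorm (\<Sum>j<n. f j) \<le> (\<Sum>j<n. b)"
          by (rule order_trans[OF qnorm_sum_le sum_mono]) (rule that)
        then show ?thesis using elim(2) by (simp add: qnorm_scaleC norm_divide field_simps)
      qed
      have r: "r \<le> 1" and s: "0 \<le> s" using rs by auto
      have "qnorm (G r) \<le> C"
        unfolding G_def by (intro avg C pt_D rs r)
      \<comment> \<open>The threshold \<open>e / C\<close> for \<open>r ^ n * qnorm (x ^ n)\<close>
        was chosen to cancel the bound \<open>C\<close> on \<open>G r\<close>.\<close>
      then have "qnorm (u r * G r) \<le> (e / C) * C"
        using elim(1) rs(1) \<open>C > 0\<close> e(1)
        by (intro order_trans[OF qnorm_mult[OF u_in G_in[OF rs(1) r]]] mult_mono)
          (auto simp: qnorm_u less_imp_le)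
      moreover have "qnorm (1 - G r) = qnorm (- (u r * G r))"
        using G[OF rs(1) r] by (intro qnorm_cong) (simp add: algebra_simps)
      ultimately have 1: "qnorm (1 - G r) \<le> e" using \<open>C > 0\<close> by (simp add: qnorm_minus)
      \<comment> \<open>Corresponding points lie at distance \<open>s - r\<close> for every
        \<open>j\<close> and every \<open>n\<close>, so the Lipschitz bound survives averaging
        without loss.\<close>
      have "G r - G s = (1 / of_nat n) *\<^sub>C (\<Sum>j<n. F (pt r j) - F (pt s j))"
        by (simp add: G_def sum_subtractf scaleC_diff_right)
      also have "qnorm \<dots> \<le> e"
      proof (rule avg)
        fix j
        have "cmod (pt r j - pt s j) = s - r"
          using rs \<omega>(2) by (simp add: pt_def right_diff_distrib[symmetric] norm_mult norm_power
              of_real_diff[symmetric] del: of_real_diff)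
        then show "qnorm (F (pt r j) - F (pt s j)) \<le> e"
          using F_lip[OF pt_D pt_D, of r s j j] rs e by auto
      qed
      finally have 2: "qnorm (1 - G s) \<le> 2 * e"
        using 1 qnorm_triangle[of "1 - G r" "G r - G s"] by simp
      \<comment> \<open>Since \<open>G s\<close> inverts \<open>1 - u s\<close> modulo
        \<open>M\<close>, \<open>u s\<close> is congruent to
        \<open>u s * (1 - G s) - (1 - G s)\<close>. With \<open>e \<le> 1/4\<close> the factor
        \<open>qnorm (1 - G s)\<close> is at most 1/2, so half of \<open>qnorm (u s)\<close> is
        absorbed on the left; this doubles \<open>2 * e\<close> to the bound
        \<open>4 * e\<close>.\<close>
      have "qnorm (u s) = qnorm (u s * (1 - G s) - (1 - G s))"
        using G[OF s rs(3)] by (intro qnorm_cong) (simp add: algebra_simps)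
      also have "\<dots> \<le> qnorm (u s) * qnorm (1 - G s) + qnorm (1 - G s)"
        using qnorm_diff_le[of "u s * (1 - G s)" "1 - G s"] qnorm_mult[OF u_in, of "1 - G s" s] G_in[OF s rs(3)] by auto
      also have "\<dots> \<le> qnorm (u s) * (1/2) + 2 * e"
        using 2 e by (intro add_mono mult_left_mono) auto
      finally show ?case using s by (simp add: qnorm_u)
    qed
  qed
qed

end


section \<open>Maximal ideals and characters\<close>

context commutative_cstar_subalgebra
begin

text \<open>Elements at distance less than 1 from 1 are invertible, with inverse in
  \<open>B\<close>, so a proper ideal contains none of them and 1 stays outside the closure.\<close>

lemma proper_ideal_closure:
  assumes "proper_ideal M"
  shows "proper_ideal (closure M)"
proof -
  have sub: "M \<subseteq> B" using assms by (simp add: proper_ideal_def)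
  have "1 \<notin> closure M"
  proof
    assume "1 \<in> closure M"
    then obtain m where m: "m \<in> M" "dist m 1 < 1"
      unfolding closure_approachable by (metis zero_less_one)
    then have "invertible_elt (1 - (1 - m))"
      by (intro invertible_elt_one_minus) (simp add: dist_norm norm_minus_commute)
    then obtain y where y: "m * y = 1" "y * m = 1" by (auto simp: invertible_elt_def)
    moreover have "y \<in> B" using inverse[OF _ y] m(1) sub by blast
    ultimately show False using assms m(1) by (metis proper_ideal_def)
  qed
  moreover have "x + y \<in> closure M" if "x \<in> closure M" "y \<in> closure M" for x y
  proof -
    obtain f g where "\<forall>n. f n \<in> M" "f \<longlonglongrightarrow> x" "\<forall>n. g n \<in> M" "g \<longlonglongrightarrow> y"
      using \<open>x \<in> closure M\<close> \<open>y \<in> closure M\<close> unfolding closure_sequential by blast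
    then show ?thesis
      using assms unfolding closure_sequential proper_ideal_def
      by (intro exI[of _ "\<lambda>n. f n + g n"]) (auto intro: tendsto_add)
  qed
  moreover have "x * y \<in> closure M" if "x \<in> closure M" "y \<in> B" for x y
  proof -
    obtain f where "\<forall>n. f n \<in> M" "f \<longlonglongrightarrow> x"
      using \<open>x \<in> closure M\<close> unfolding closure_sequential by blast
    then show ?thesis
      using assms that(2) unfolding closure_sequential proper_ideal_def
      by (intro exI[of _ "\<lambda>n. f n * y"]) (auto intro: tendsto_mult_right)
  qed
  moreover have "0 \<in> closure M"
    using assms closure_subset[of M] by (auto simp: proper_ideal_def)
  ultimately show ?thesis
    unfolding proper_ideal_def using closure_minimal[OF sub closed] by blast
qed

definition maximal_ideal :: "'a set \<Rightarrow> bool" where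
  "maximal_ideal M \<longleftrightarrow> proper_ideal M \<and> (\<forall>N. proper_ideal N \<longrightarrow> M \<subseteq> N \<longrightarrow> N = M)"

text \<open>The closure is again a proper ideal, so maximality makes it equal to
  \<open>M\<close>.\<close>

lemma closed_maximal_ideal:
  assumes "maximal_ideal M"
  shows "closed_proper_ideal B M"
proof
  show "proper_ideal M" using assms by (simp add: maximal_ideal_def)
  then have "closure M = M"
    using assms proper_ideal_closure closure_subset by (auto simp: maximal_ideal_def)
  then show "closed M" by (metis closed_closure)
qed

text \<open>Zorn's lemma for the proper ideals containing \<open>x\<close>. The principal ideal
  \<open>x B\<close> is one of them because \<open>x\<close> is not invertible, and the union of a
  chain stays proper because 1 lies in no member.\<close>

lemma maximal_ideal_exists:
  assumes x: "x \<in> B" "\<not> invertible_elt x"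
  obtains M where "maximal_ideal M" "x \<in> M"
proof -
  define \<A> where "\<A> = {M. proper_ideal M \<and> x \<in> M}"
  have not_one: "1 \<notin> (\<lambda>y. x * y) ` B"
  proof
    assume "1 \<in> (\<lambda>y. x * y) ` B"
    then obtain y where y: "1 = x * y" "y \<in> B" by (rule imageE)
    have xy: "x * y = 1" by (rule y(1)[symmetric])
    moreover have "y * x = 1" unfolding commute[OF y(2) x(1)] by (rule xy)
    ultimately have "invertible_elt x" unfolding invertible_elt_def by blast
    with x(2) show False by contradiction
  qed
  have "(\<lambda>y. x * y) ` B \<subseteq> B" using x by auto
  moreover have "x \<in> (\<lambda>y. x * y) ` B" by (rule image_eqI[of _ _ 1]) auto
  moreover have "0 \<in> (\<lambda>y. x * y) ` B" by (rule image_eqI[of _ _ 0]) auto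
  moreover have "u + v \<in> (\<lambda>y. x * y) ` B" if "u \<in> (\<lambda>y. x * y) ` B" "v \<in> (\<lambda>y. x * y) ` B" for u v
    using that by (elim imageE) (simp flip: distrib_left)
  moreover have "u * v \<in> (\<lambda>y. x * y) ` B" if "u \<in> (\<lambda>y. x * y) ` B" "v \<in> B" for u v
    using that by (elim imageE) (simp add: mult.assoc)
  ultimately have "(\<lambda>y. x * y) ` B \<in> \<A>"
    using not_one by (simp add: \<A>_def proper_ideal_def)
  moreover have "\<Union>\<C> \<in> \<A>" if "\<C> \<noteq> {}" "subset.chain \<A> \<C>" for \<C>
  proof -
    have sub: "\<And>M. M \<in> \<C> \<Longrightarrow> proper_ideal M \<and> x \<in> M"
      and chain: "\<And>M N. M \<in> \<C> \<Longrightarrow> N \<in> \<C> \<Longrightarrow> M \<subseteq> N \<or> N \<subseteq> M"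
      using that(2) by (auto simp: subset_chain_def \<A>_def)
    have "y + z \<in> \<Union>\<C>" if yz: "y \<in> \<Union>\<C>" "z \<in> \<Union>\<C>" for y z
    proof -
      obtain M N where MN: "M \<in> \<C>" "y \<in> M" "N \<in> \<C>" "z \<in> N" using yz by blast
      obtain K where "K \<in> \<C>" "y \<in> K" "z \<in> K"
        using chain[OF MN(1,3)] MN by blast
      moreover then have "y + z \<in> K" using sub[of K] by (simp add: proper_ideal_def)
      ultimately show ?thesis by blast
    qed
    moreover have "y * z \<in> \<Union>\<C>" if yz: "y \<in> \<Union>\<C>" "z \<in> B" for y z
    proof -
      obtain K where "K \<in> \<C>" "y \<in> K" using yz by blast
      moreover then have "y * z \<in> K" using sub[of K] yz by (simp add: proper_ideal_def)
      ultimately show ?thesis by blast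
    qed
    moreover have "\<Union>\<C> \<subseteq> B" "1 \<notin> \<Union>\<C>" using sub unfolding proper_ideal_def by blast+
    moreover obtain M where "M \<in> \<C>" using \<open>\<C> \<noteq> {}\<close> by blast
    moreover then have "0 \<in> \<Union>\<C>" "x \<in> \<Union>\<C>" using sub[of M] by (auto simp: proper_ideal_def)
    ultimately show ?thesis unfolding \<A>_def proper_ideal_def by blast
  qed
  ultimately have "\<exists>M\<in>\<A>. \<forall>X\<in>\<A>. M \<subseteq> X \<longrightarrow> X = M"
    by (intro subset_Zorn_nonempty) auto
  then obtain M where "M \<in> \<A>" "\<forall>X\<in>\<A>. M \<subseteq> X \<longrightarrow> X = M" by blast
  then have "maximal_ideal M" "x \<in> M"
    by (auto simp: maximal_ideal_def \<A>_def)
  then show ?thesis by (rule that)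
qed

text \<open>The ideal \<open>M + y B\<close> is strictly larger than \<open>M\<close>, hence
  contains 1.\<close>

lemma maximal_ideal_inverse:
  assumes M: "maximal_ideal M" and y: "y \<in> B" "y \<notin> M"
  obtains z where "z \<in> B" "1 - y * z \<in> M"
proof -
  interpret closed_proper_ideal B M by (rule closed_maximal_ideal[OF M])
  define N where "N = {m + y * b | m b. m \<in> M \<and> b \<in> B}"
  have "y \<in> N" unfolding N_def using ideal_zero one by force
  have "M \<subseteq> N" unfolding N_def using zero by force
  have "\<not> proper_ideal N"
    using M \<open>M \<subseteq> N\<close> \<open>y \<in> N\<close> y(2) by (auto simp: maximal_ideal_def)
  moreover have "N \<subseteq> B" unfolding N_def using y ideal_subset by auto
  moreover have "0 \<in> N" using \<open>M \<subseteq> N\<close> ideal_zero by blast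
  moreover have "u + v \<in> N" if uN: "u \<in> N" and vN: "v \<in> N" for u v
  proof -
    obtain m b where "u = m + y * b" "m \<in> M" "b \<in> B" using uN unfolding N_def by blast
    moreover obtain m' b' where "v = m' + y * b'" "m' \<in> M" "b' \<in> B"
      using vN unfolding N_def by blast
    ultimately have "u + v = (m + m') + y * (b + b')" "m + m' \<in> M" "b + b' \<in> B"
      by (auto simp: algebra_simps ideal_add)
    then show ?thesis unfolding N_def by blast
  qed
  moreover have "u * v \<in> N" if uN: "u \<in> N" and vB: "v \<in> B" for u v
  proof -
    obtain m b where "u = m + y * b" "m \<in> M" "b \<in> B"
      using uN unfolding N_def by blast
    then have "u * v = m * v + y * (b * v)" "m * v \<in> M" "b * v \<in> B"
      using vB by (auto simp: algebra_simps ideal_mult)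
    then show ?thesis unfolding N_def by blast
  qed
  ultimately have "1 \<in> N" unfolding proper_ideal_def by blast
  then obtain m b where mb: "1 = m + y * b" "m \<in> M" "b \<in> B" unfolding N_def by blast
  then have "1 - y * b \<in> M" by (metis add_diff_cancel_right')
  with mb(3) show ?thesis by (rule that)
qed

text \<open>Otherwise every \<open>h - z\<close> is invertible modulo \<open>M\<close>, hence so is
  every \<open>1 - z c h\<close>, and the powers of \<open>c h\<close> tend to 0 modulo
  \<open>M\<close> for each scalar \<open>c > 0\<close>. But if \<open>g\<close> inverts
  \<open>h\<close> modulo \<open>M\<close> and \<open>c\<close> exceeds \<open>qnorm g\<close>, then
  \<open>c ^ n * qnorm (h ^ n)\<close> does not decrease with \<open>n\<close>, so it never falls
  below \<open>qnorm 1 > 0\<close>.\<close>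

theorem gelfand_mazur:
  assumes M: "maximal_ideal M" and h: "h \<in> B"
  shows "\<exists>z. h - z *\<^sub>C 1 \<in> M"
proof (rule ccontr)
  interpret closed_proper_ideal B M by (rule closed_maximal_ideal[OF M])
  assume *: "\<not> (\<exists>z. h - z *\<^sub>C 1 \<in> M)"
  have res: "\<exists>y\<in>B. 1 - (h - z *\<^sub>C 1) * y \<in> M" for z
    using maximal_ideal_inverse[OF M, of "h - z *\<^sub>C 1"] h * by blast
  obtain g where g: "g \<in> B" "1 - h * g \<in> M" using res[of 0] by auto
  define c where "c = qnorm g + 1"
  have "c > 0" by (simp add: c_def add_nonneg_pos)
  have "(\<lambda>n. qnorm ((c *\<^sub>C h) ^ n)) \<longlonglongrightarrow> 0"
  proof (rule qnorm_power_tendsto_zero)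
    fix z :: complex
    show "\<exists>y\<in>B. 1 - (1 - z *\<^sub>C c *\<^sub>C h) * y \<in> M"
    proof (cases "z = 0")
      case False
      \<comment> \<open>Chosen so that \<open>1 - z c h = - z c (h - w)\<close>.\<close>
      define w where "w = 1 / (z * c)"
      obtain y where y: "y \<in> B" "1 - (h - w *\<^sub>C 1) * y \<in> M" using res by blast
      have "(1 - z *\<^sub>C c *\<^sub>C h) * ((- w) *\<^sub>C y) = (h - w *\<^sub>C 1) * y"
        using False \<open>c > 0\<close> by (simp add: w_def algebra_simps scaleC_diff_right)
      with y show ?thesis by (metis scaleC)
    qed (intro bexI[of _ 1], auto)
  qed (use h in auto)
  then have "(\<lambda>n. c ^ n * qnorm (h ^ n)) \<longlonglongrightarrow> 0"
    using \<open>c > 0\<close> by (simp add: power_scaleC qnorm_scaleC norm_power)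
  moreover have "qnorm 1 \<le> c ^ n * qnorm (h ^ n)" for n
  proof (induction n)
    case (Suc n)
    have "h ^ n * (1 - h * g) \<in> M" using g h by (intro ideal_mult_left) auto
    also have "h ^ n * (1 - h * g) = h ^ n - h ^ Suc n * g"
      by (simp add: right_diff_distrib mult.assoc power_Suc2 del: power_Suc)
    finally have "qnorm (h ^ n) = qnorm (h ^ Suc n * g)" by (rule qnorm_cong)
    also have "\<dots> \<le> qnorm (h ^ Suc n) * qnorm g"
      using g(1) power[OF h, of "Suc n"] by (rule qnorm_mult[rotated])
    also have "\<dots> \<le> qnorm (h ^ Suc n) * c"
      by (intro mult_left_mono) (auto simp: c_def)
    finally have "c ^ n * qnorm (h ^ n) \<le> c ^ n * (qnorm (h ^ Suc n) * c)"
      using \<open>c > 0\<close> by (intro mult_left_mono) auto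
    with Suc show ?case by (simp add: mult_ac)
  qed simp
  ultimately have "qnorm 1 \<le> 0" using LIMSEQ_le_const by blast
  then show False using qnorm_one_pos by simp
qed

text \<open>Values outside \<open>B\<close> are arbitrary. Continuity and compatibility with the
  star are consequences: see \<open>character_le_norm\<close> and
  \<open>character_star\<close>.\<close>

definition character :: "('a \<Rightarrow> complex) \<Rightarrow> bool" where
  "character \<psi> \<longleftrightarrow> \<psi> 1 = 1 \<and> (\<forall>x\<in>B. \<forall>y\<in>B. \<psi> (x + y) = \<psi> x + \<psi> y) \<and>
    (\<forall>x\<in>B. \<forall>y\<in>B. \<psi> (x * y) = \<psi> x * \<psi> y) \<and> (\<forall>c. \<forall>x\<in>B. \<psi> (c *\<^sub>C x) = c * \<psi> x)"

lemma
  assumes "character \<psi>"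
  shows character_one: "\<psi> 1 = 1"
    and character_add: "x \<in> B \<Longrightarrow> y \<in> B \<Longrightarrow> \<psi> (x + y) = \<psi> x + \<psi> y"
    and character_mult: "x \<in> B \<Longrightarrow> y \<in> B \<Longrightarrow> \<psi> (x * y) = \<psi> x * \<psi> y"
    and character_scaleC: "x \<in> B \<Longrightarrow> \<psi> (c *\<^sub>C x) = c * \<psi> x"
  using assms by (auto simp: character_def)

lemma character_diff: "character \<psi> \<Longrightarrow> x \<in> B \<Longrightarrow> y \<in> B \<Longrightarrow> \<psi> (x - y) = \<psi> x - \<psi> y"
  using character_add[of \<psi> "x - y" y] by simp

text \<open>By Gelfand-Mazur the quotient by a maximal ideal containing \<open>x\<close> is the
  field of complex numbers; \<open>\<psi> y\<close> is the unique scalar congruent to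
  \<open>y\<close>.\<close>

lemma character_vanishing_exists:
  assumes "x \<in> B" "\<not> invertible_elt x"
  obtains \<psi> where "character \<psi>" "\<psi> x = 0"
proof -
  obtain M where M: "maximal_ideal M" "x \<in> M" by (rule maximal_ideal_exists[OF assms])
  interpret closed_proper_ideal B M by (rule closed_maximal_ideal[OF M(1)])
  have unique: "z = w" if "y - z *\<^sub>C 1 \<in> M" "y - w *\<^sub>C 1 \<in> M" for y z w
  proof (rule ccontr)
    assume "z \<noteq> w"
    have "(1 / (z - w)) *\<^sub>C ((y - w *\<^sub>C 1) - (y - z *\<^sub>C 1)) \<in> M"
      by (intro ideal_scaleC ideal_diff[OF that(2,1)])
    also have "(1 / (z - w)) *\<^sub>C ((y - w *\<^sub>C 1) - (y - z *\<^sub>C 1)) = (1 / (z - w)) *\<^sub>C (z - w) *\<^sub>C 1"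
      by (simp only: scaleC_diff_left) simp
    finally show False using \<open>z \<noteq> w\<close> ideal_one by simp
  qed
  define \<psi> where "\<psi> y = (SOME z. y - z *\<^sub>C 1 \<in> M)" for y
  have \<psi>: "y - \<psi> y *\<^sub>C 1 \<in> M" if "y \<in> B" for y
    unfolding \<psi>_def by (rule someI_ex[OF gelfand_mazur[OF M(1) that]])
  have \<psi>_eq: "\<psi> y = z" if "y \<in> B" "y - z *\<^sub>C 1 \<in> M" for y z
    using unique[OF \<psi>] that by blast
  have "character \<psi>"
    unfolding character_def
  proof (intro conjI ballI allI)
    show "\<psi> 1 = 1" by (rule \<psi>_eq) auto
    fix y assume y: "y \<in> B"
    show "\<psi> (c *\<^sub>C y) = c * \<psi> y" for c
      using ideal_scaleC[OF \<psi>[OF y], of c] y by (intro \<psi>_eq) (auto simp: scaleC_diff_right)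
    fix z assume z: "z \<in> B"
    show "\<psi> (y + z) = \<psi> y + \<psi> z"
      using ideal_add[OF \<psi>[OF y] \<psi>[OF z]] y z by (intro \<psi>_eq) (auto simp: scaleC_add_left algebra_simps)
    \<comment> \<open>The sum telescopes to \<open>y z\<close> minus the scalar
      \<open>\<psi> y * \<psi> z\<close>.\<close>
    have "(y - \<psi> y *\<^sub>C 1) * z + \<psi> y *\<^sub>C (z - \<psi> z *\<^sub>C 1) \<in> M"
      using y z by (intro ideal_add ideal_mult ideal_scaleC \<psi>)
    then show "\<psi> (y * z) = \<psi> y * \<psi> z"
      using y z by (intro \<psi>_eq) (auto simp: scaleC_diff_right algebra_simps)
  qed
  moreover have "\<psi> x = 0" using M(2) assms(1) by (intro \<psi>_eq) auto
  ultimately show ?thesis by (rule that)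
qed

text \<open>A non-invertible \<open>x - z\<close> is annihilated by some character. Conversely a
  character annihilates \<open>x - \<psi> x\<close>, so an inverse, which would lie in
  \<open>B\<close>, would give \<open>\<psi> 1 = 0\<close>.\<close>

lemma spectrum_eq_characters:
  assumes x: "x \<in> B"
  shows "spectrum x = {\<psi> x | \<psi>. character \<psi>}"
proof safe
  fix z assume "z \<in> spectrum x"
  then have "\<not> invertible_elt (x - z *\<^sub>C 1)" by (simp add: spectrum_def)
  with x obtain \<psi> where \<psi>: "character \<psi>" "\<psi> (x - z *\<^sub>C 1) = 0"
    using character_vanishing_exists[of "x - z *\<^sub>C 1"] by blast
  then have "z = \<psi> x"
    using x by (simp add: character_diff[OF \<psi>(1)] character_scaleC[OF \<psi>(1)] character_one[OF \<psi>(1)])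
  with \<psi> show "\<exists>\<psi>. z = \<psi> x \<and> character \<psi>" by blast
next
  fix \<psi> assume \<psi>: "character \<psi>"
  show "\<psi> x \<in> spectrum x"
  proof (rule ccontr)
    assume "\<psi> x \<notin> spectrum x"
    then obtain y where y: "(x - \<psi> x *\<^sub>C 1) * y = 1" "y * (x - \<psi> x *\<^sub>C 1) = 1"
      by (auto simp: spectrum_def invertible_elt_def)
    have "y \<in> B" by (rule inverse[OF _ y]) (use x in auto)
    have "\<psi> ((x - \<psi> x *\<^sub>C 1) * y) = 0"
      using x by (simp add: character_mult[OF \<psi>] character_diff[OF \<psi>] character_scaleC[OF \<psi>]
          character_one[OF \<psi>] \<open>y \<in> B\<close>)
    then show False using y(1) character_one[OF \<psi>] by simp
  qed
qed

section \<open>Characters are contractive and respect the star\<close>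

lemma character_in_spectrum: "character \<psi> \<Longrightarrow> x \<in> B \<Longrightarrow> \<psi> x \<in> spectrum x"
  using spectrum_eq_characters by blast

lemma character_le_norm: "character \<psi> \<Longrightarrow> x \<in> B \<Longrightarrow> cmod (\<psi> x) \<le> norm x"
  by (rule spectrum_bounded[OF character_in_spectrum])

text \<open>Arens' argument: shifting \<open>h\<close> by \<open>\<i> t\<close> moves \<open>\<psi> h\<close> linearly in \<open>t\<close>, while the
  \<open>C\<^sup>*\<close>-identity bounds the square of the norm by \<open>norm h ^ 2 + t ^ 2\<close>.\<close>

lemma character_selfadjoint_real:
  assumes \<psi>: "character \<psi>" and h: "h \<in> B" "star h = h"
  shows "Im (\<psi> h) = 0"
proof -
  have ineq: "2 * (Im (\<psi> h) * t) \<le> norm h * norm h" for t :: real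
  proof -
    define u where "u = h + (\<i> * t) *\<^sub>C 1"
    have "u \<in> B" using h by (simp add: u_def)
    have "\<psi> u = \<psi> h + \<i> * t"
      using h by (simp add: u_def character_add[OF \<psi>] character_scaleC[OF \<psi>] character_one[OF \<psi>])
    then have "(cmod (\<psi> h + \<i> * t))\<^sup>2 \<le> norm u * norm u"
      using character_le_norm[OF \<psi> \<open>u \<in> B\<close>] by (simp add: power2_eq_square mult_mono)
    also have "\<dots> = norm (star u * u)" by (simp add: norm_star_mult_self)
    also have "star u * u = h * h + complex_of_real (t\<^sup>2) *\<^sub>C 1"
      using h by (simp add: u_def star_add star_scaleC scaleC_diff_right algebra_simps power2_eq_square)
    also have "norm \<dots> \<le> norm h * norm h + t\<^sup>2"
      using norm_triangle_ineq[of "h * h" "complex_of_real (t\<^sup>2) *\<^sub>C 1"] norm_mult_ineq[of h h]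
      by (simp add: norm_scaleC norm_power)
    finally have "(Re (\<psi> h))\<^sup>2 + (Im (\<psi> h) + t)\<^sup>2 \<le> norm h * norm h + t\<^sup>2"
      by (simp add: cmod_power2)
    then have "(Re (\<psi> h))\<^sup>2 + (Im (\<psi> h))\<^sup>2 + 2 * (Im (\<psi> h) * t) \<le> norm h * norm h"
      by (simp add: power2_sum mult.assoc)
    then show ?thesis
      using sum_power2_ge_zero[of "Re (\<psi> h)" "Im (\<psi> h)"] by linarith
  qed
  show ?thesis
  proof (rule ccontr)
    assume "Im (\<psi> h) \<noteq> 0"
    define N where "N = norm h * norm h"
    have "2 * (N + 1) \<le> N"
      using ineq[of "(N + 1) / Im (\<psi> h)"] \<open>Im (\<psi> h) \<noteq> 0\<close> by (simp add: N_def)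
    then have "N + 2 \<le> 0" by (simp add: distrib_left)
    moreover have "0 \<le> N" by (simp add: N_def)
    ultimately show False by simp
  qed
qed

text \<open>The values at the self-adjoint elements \<open>x + star x\<close> and
  \<open>\<i> *\<^sub>C (x - star x)\<close> are real, which determines
  \<open>\<psi> (star x)\<close>.\<close>

lemma character_star:
  assumes \<psi>: "character \<psi>" and x: "x \<in> B"
  shows "\<psi> (star x) = cnj (\<psi> x)"
proof -
  have "Im (\<psi> (x + star x)) = 0"
    using x by (intro character_selfadjoint_real \<psi>) (auto simp: star_add add.commute)
  moreover have "Im (\<psi> (\<i> *\<^sub>C (x - star x))) = 0"
    using x by (intro character_selfadjoint_real \<psi>) (auto simp: star_diff star_scaleC scaleC_diff_right)
  ultimately show ?thesis
    using x by (simp add: character_add[OF \<psi>] character_diff[OF \<psi>] character_scaleC[OF \<psi>] complex_eq_iff)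
qed

section \<open>The norm is attained by a character\<close>

lemma zero_ideal: "closed_proper_ideal B {0}"
  by unfold_locales (auto simp: proper_ideal_def)

text \<open>Let \<open>k\<close> be \<open>h\<close> scaled to norm 1. Repeated squaring with the
  C*-identity gives \<open>norm (k ^ (2 ^ n)) = 1\<close>, so the powers of \<open>k\<close> do not
  tend to 0. For the zero ideal, where \<open>qnorm\<close> is the norm, this forces some
  \<open>1 - z k\<close> with \<open>cmod z \<le> 1\<close> to be non-invertible; a character
  vanishing there satisfies \<open>z * \<psi> k = 1\<close>, hence
  \<open>cmod (\<psi> k) \<ge> 1\<close>.\<close>

lemma norm_attained_selfadjoint:
  assumes h: "h \<in> B" "star h = h"
  obtains \<psi> where "character \<psi>" "cmod (\<psi> h) = norm h"
proof (cases "h = 0")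
  case True
  have "\<not> invertible_elt (0::'a)" by (simp add: invertible_elt_def)
  then obtain \<psi> where "character \<psi>" "\<psi> 0 = 0" using character_vanishing_exists[OF zero] by blast
  with True show ?thesis by (intro that[of \<psi>]) auto
next
  case False
  define k where "k = complex_of_real (1 / norm h) *\<^sub>C h"
  have k: "k \<in> B" "star k = k" "norm k = 1"
    using h False by (simp_all add: k_def star_scaleC norm_scaleC norm_divide)
  interpret closed_proper_ideal B "{0}" by (rule zero_ideal)
  have qnorm_eq: "qnorm x = norm x" for x by (simp add: qnorm_def dist_norm)
  have star_pow: "star (k ^ n) = k ^ n" for n
    by (induction n) (simp_all add: star_mult k power_commutes)
  have pow2: "norm (k ^ (2 ^ n)) = 1" for n
  proof (induction n)
    case (Suc n)
    have "norm (k ^ (2 ^ Suc n)) = norm (star (k ^ (2 ^ n)) * k ^ (2 ^ n))"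
      by (simp add: star_pow mult_2 power_add)
    with Suc show ?case by (simp add: norm_star_mult_self)
  qed (simp add: k)
  have "\<not> (\<lambda>n. qnorm (k ^ n)) \<longlonglongrightarrow> 0"
  proof
    assume "(\<lambda>n. qnorm (k ^ n)) \<longlonglongrightarrow> 0"
    then have "((\<lambda>n. qnorm (k ^ n)) \<circ> (\<lambda>n. 2 ^ n)) \<longlonglongrightarrow> 0"
      by (rule LIMSEQ_subseq_LIMSEQ) (simp add: strict_mono_def)
    then show False by (simp add: o_def qnorm_eq pow2 LIMSEQ_const_iff)
  qed
  then obtain z where z: "cmod z \<le> 1" "\<not> (\<exists>y\<in>B. 1 - (1 - z *\<^sub>C k) * y \<in> {0})"
    using qnorm_power_tendsto_zero[OF k(1)] by blast
  have "\<not> invertible_elt (1 - z *\<^sub>C k)"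
  proof
    assume "invertible_elt (1 - z *\<^sub>C k)"
    then obtain y where y: "(1 - z *\<^sub>C k) * y = 1" "y * (1 - z *\<^sub>C k) = 1"
      by (auto simp: invertible_elt_def)
    have "y \<in> B" by (rule inverse[OF _ y]) (use k in auto)
    then show False using y(1) z(2) by auto
  qed
  then obtain \<psi> where \<psi>: "character \<psi>" "\<psi> (1 - z *\<^sub>C k) = 0"
    using character_vanishing_exists[of "1 - z *\<^sub>C k"] k(1) by blast
  then have "z * \<psi> k = 1"
    using k by (simp add: character_diff[OF \<psi>(1)] character_scaleC[OF \<psi>(1)] character_one[OF \<psi>(1)])
  then have "1 = cmod z * cmod (\<psi> k)" by (metis norm_mult norm_one)
  also have "\<dots> \<le> 1 * cmod (\<psi> k)" using z(1) by (intro mult_right_mono) auto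
  finally have "cmod (\<psi> k) = 1" using character_le_norm[OF \<psi>(1) k(1)] k(3) by simp
  then have "cmod (\<psi> h) = norm h"
    using False h by (simp add: k_def character_scaleC[OF \<psi>(1)] norm_mult norm_divide)
  with \<psi>(1) show ?thesis by (rule that)
qed

text \<open>For the self-adjoint element \<open>star x * x\<close>, both sides become the squares of
  those for \<open>x\<close>.\<close>

lemma norm_attained:
  assumes x: "x \<in> B"
  obtains \<psi> where "character \<psi>" "cmod (\<psi> x) = norm x"
proof -
  obtain \<psi> where \<psi>: "character \<psi>" "cmod (\<psi> (star x * x)) = norm (star x * x)"
  proof (rule norm_attained_selfadjoint)
    show "star x * x \<in> B" "star (star x * x) = star x * x" using x by (auto simp: star_mult)
  qed
  then have "(cmod (\<psi> x))\<^sup>2 = (norm x)\<^sup>2"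
    using x by (simp add: character_mult[OF \<psi>(1)] character_star[OF \<psi>(1)] norm_star_mult_self norm_mult power2_eq_square)
  then have "cmod (\<psi> x) = norm x" by (simp add: power2_eq_iff_nonneg)
  with \<psi>(1) show ?thesis by (rule that)
qed

end


section \<open>Continuous functional calculus in a commutative subalgebra\<close>

context commutative_cstar_subalgebra
begin

text \<open>The element \<open>x\<close> is \<open>f(a)\<close> in the sense that its Gelfand transform is \<open>f\<close> composed with
  that of \<open>a\<close>. Being a relation between \<open>f\<close> and \<open>x\<close>, this makes sense before \<open>f(a)\<close> is known to
  exist.\<close>

definition gelfand_rep :: "'a \<Rightarrow> (complex \<Rightarrow> complex) \<Rightarrow> 'a \<Rightarrow> bool" where
  "gelfand_rep a f x \<longleftrightarrow> x \<in> B \<and> (\<forall>\<psi>. character \<psi> \<longrightarrow> \<psi> x = f (\<psi> a))"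

lemma gelfand_repD:
  assumes "gelfand_rep a f x"
  shows "x \<in> B" and "character \<psi> \<Longrightarrow> \<psi> x = f (\<psi> a)"
  using assms unfolding gelfand_rep_def by blast+

lemma gelfand_rep_id: "a \<in> B \<Longrightarrow> gelfand_rep a (\<lambda>z. z) a"
  by (simp add: gelfand_rep_def)

lemma gelfand_rep_const: "gelfand_rep a (\<lambda>_. c) (c *\<^sub>C 1)"
  by (simp add: gelfand_rep_def character_scaleC[OF _ one] character_one)

lemma gelfand_rep_add:
  "gelfand_rep a f x \<Longrightarrow> gelfand_rep a g y \<Longrightarrow> gelfand_rep a (\<lambda>z. f z + g z) (x + y)"
  unfolding gelfand_rep_def by (metis add character_add)

lemma gelfand_rep_diff:
  "gelfand_rep a f x \<Longrightarrow> gelfand_rep a g y \<Longrightarrow> gelfand_rep a (\<lambda>z. f z - g z) (x - y)"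
  unfolding gelfand_rep_def by (metis diff character_diff)

lemma gelfand_rep_mult:
  "gelfand_rep a f x \<Longrightarrow> gelfand_rep a g y \<Longrightarrow> gelfand_rep a (\<lambda>z. f z * g z) (x * y)"
  unfolding gelfand_rep_def by (metis mult character_mult)

lemma gelfand_rep_scaleC: "gelfand_rep a f x \<Longrightarrow> gelfand_rep a (\<lambda>z. c * f z) (c *\<^sub>C x)"
  unfolding gelfand_rep_def by (metis scaleC character_scaleC)

lemma gelfand_rep_star: "gelfand_rep a f x \<Longrightarrow> gelfand_rep a (\<lambda>z. cnj (f z)) (star x)"
  unfolding gelfand_rep_def by (metis star character_star)

lemma gelfand_rep_spectrum:
  assumes "a \<in> B" "gelfand_rep a f x"
  shows "spectrum x = f ` spectrum a"
proof -
  note x = gelfand_repD[OF assms(2)]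
  show ?thesis
  proof (intro set_eqI iffI)
    fix z assume "z \<in> spectrum x"
    then obtain \<psi> where \<psi>: "z = \<psi> x" "character \<psi>"
      unfolding spectrum_eq_characters[OF x(1)] by blast
    have "z = f (\<psi> a)" using \<psi>(1) x(2)[OF \<psi>(2)] by (rule trans)
    then show "z \<in> f ` spectrum a"
      using character_in_spectrum[OF \<psi>(2) assms(1)] by (rule image_eqI)
  next
    fix z assume "z \<in> f ` spectrum a"
    then obtain w where "z = f w" "w \<in> spectrum a" by (rule imageE)
    then obtain \<psi> where \<psi>: "z = f (\<psi> a)" "character \<psi>"
      unfolding spectrum_eq_characters[OF assms(1)] by blast
    have "z = \<psi> x" using \<psi>(1) x(2)[OF \<psi>(2), symmetric] by (rule trans)
    then show "z \<in> spectrum x" using character_in_spectrum[OF \<psi>(2) x(1)] by (rule ssubst)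
  qed
qed

lemma gelfand_rep_cong:
  assumes "a \<in> B" "gelfand_rep a f x" "\<And>z. z \<in> spectrum a \<Longrightarrow> f z = g z"
  shows "gelfand_rep a g x"
  unfolding gelfand_rep_def
proof (intro conjI allI impI)
  show "x \<in> B" by (rule gelfand_repD(1)[OF assms(2)])
  fix \<psi> assume \<psi>: "character \<psi>"
  show "\<psi> x = g (\<psi> a)"
    using gelfand_repD(2)[OF assms(2) \<psi>] assms(3)[OF character_in_spectrum[OF \<psi> assms(1)]]
    by (rule trans)
qed

lemma gelfand_rep_norm_le:
  assumes "a \<in> B" "gelfand_rep a f x" "z \<in> spectrum a"
  shows "cmod (f z) \<le> norm x"
  using gelfand_rep_spectrum[OF assms(1,2)] assms(3) spectrum_bounded[of "f z" x] by blast

lemma gelfand_rep_norm_attained: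
  assumes "a \<in> B" "gelfand_rep a f x"
  shows "\<exists>z\<in>spectrum a. norm x = cmod (f z)"
proof -
  note x = gelfand_repD[OF assms(2)]
  obtain \<psi> where \<psi>: "character \<psi>" "cmod (\<psi> x) = norm x" by (rule norm_attained[OF x(1)])
  have "\<psi> a \<in> spectrum a" by (rule character_in_spectrum[OF \<psi>(1) assms(1)])
  then show ?thesis using \<psi>(2) unfolding x(2)[OF \<psi>(1)] by metis
qed

text \<open>The difference represents the zero function, and its norm is a value of that
  function.\<close>

lemma gelfand_rep_unique:
  assumes "a \<in> B" "gelfand_rep a f x" "gelfand_rep a f y"
  shows "x = y"
  using gelfand_rep_norm_attained[OF assms(1) gelfand_rep_diff[OF assms(2,3)]] by simp

text \<open>The Gelfand transform is isometric, so uniform convergence of the functions makes the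
  elements a Cauchy sequence. The limit stays in the closed set \<open>B\<close>, and contractivity
  of characters identifies its transform.\<close>

lemma gelfand_rep_limit:
  assumes a: "a \<in> B" and rep: "\<And>n. gelfand_rep a (f n) (x n)"
    and lim: "uniform_limit (spectrum a) f g sequentially"
  shows "\<exists>y. gelfand_rep a g y"
proof -
  have "Cauchy x"
  proof (rule metric_CauchyI)
    fix e :: real assume "e > 0"
    then obtain N where N: "\<And>n z. n \<ge> N \<Longrightarrow> z \<in> spectrum a \<Longrightarrow> dist (f n z) (g z) < e / 2"
      using lim unfolding uniform_limit_iff eventually_sequentially by (meson half_gt_zero)
    have "dist (x m) (x n) < e" if mn: "m \<ge> N" "n \<ge> N" for m n
    proof -
      obtain z where z: "z \<in> spectrum a" "norm (x m - x n) = cmod (f m z - f n z)"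
        using gelfand_rep_norm_attained[OF a gelfand_rep_diff[OF rep[of m] rep[of n]]] by blast
      have "dist (f m z) (f n z) < e"
        using N[OF mn(1) z(1)] N[OF mn(2) z(1)] by (rule dist_triangle_half_l)
      then show ?thesis using z(2) by (simp add: dist_norm)
    qed
    then show "\<exists>M. \<forall>m\<ge>M. \<forall>n\<ge>M. dist (x m) (x n) < e" by blast
  qed
  then obtain y where y: "x \<longlonglongrightarrow> y"
    using Cauchy_convergent convergent_def by blast
  have "y \<in> B"
    using closed y rep unfolding closed_sequential_limits gelfand_rep_def by blast
  have "\<psi> y = g (\<psi> a)" if \<psi>: "character \<psi>" for \<psi>
  proof (rule LIMSEQ_unique)
    show "(\<lambda>n. f n (\<psi> a)) \<longlonglongrightarrow> g (\<psi> a)"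
      by (intro tendsto_uniform_limitI[OF lim] character_in_spectrum \<psi> a)
    have "(\<lambda>n. norm (x n - y)) \<longlonglongrightarrow> 0"
      using y by (simp add: LIM_zero tendsto_norm_zero)
    then have "(\<lambda>n. f n (\<psi> a) - \<psi> y) \<longlonglongrightarrow> 0"
    proof (rule Lim_null_comparison[rotated], intro always_eventually allI)
      fix n
      have x: "x n \<in> B" "\<psi> (x n) = f n (\<psi> a)" using gelfand_repD[OF rep[of n]] \<psi> by blast+
      show "norm (f n (\<psi> a) - \<psi> y) \<le> norm (x n - y)"
        using character_le_norm[OF \<psi>, of "x n - y"] x \<open>y \<in> B\<close> by (simp add: character_diff[OF \<psi>])
    qed
    then show "(\<lambda>n. f n (\<psi> a)) \<longlonglongrightarrow> \<psi> y" by (simp add: LIM_zero_iff)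
  qed
  with \<open>y \<in> B\<close> show ?thesis unfolding gelfand_rep_def by blast
qed

text \<open>Stone-Weierstrass in its real form. The star puts \<open>Re\<close> and
  \<open>Im\<close> among the representable functions, and these separate points.\<close>

lemma gelfand_rep_exists_real:
  fixes f :: "complex \<Rightarrow> real"
  assumes a: "a \<in> B" and f: "continuous_on (spectrum a) f"
  shows "\<exists>x. gelfand_rep a (\<lambda>z. complex_of_real (f z)) x"
proof -
  define R where "R = {g. continuous_on (spectrum a) g \<and> (\<exists>x. gelfand_rep a (\<lambda>z. complex_of_real (g z)) x)}"
  have RI: "g \<in> R" if "continuous_on (spectrum a) g" "gelfand_rep a h x" "h = (\<lambda>z. complex_of_real (g z))" for g h x
    using that by (auto simp: R_def)
  have "(\<lambda>z. (1/2) * (z + cnj z)) = (\<lambda>z. complex_of_real (Re z))"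
    by (auto simp: complex_eq_iff)
  from RI[OF _ gelfand_rep_scaleC[OF gelfand_rep_add[OF gelfand_rep_id[OF a]
        gelfand_rep_star[OF gelfand_rep_id[OF a]]]] this]
  have Re: "Re \<in> R" by (simp add: continuous_on_Re)
  have "(\<lambda>z. (- \<i> / 2) * (z - cnj z)) = (\<lambda>z. complex_of_real (Im z))"
    by (auto simp: complex_eq_iff)
  from RI[OF _ gelfand_rep_scaleC[OF gelfand_rep_diff[OF gelfand_rep_id[OF a]
        gelfand_rep_star[OF gelfand_rep_id[OF a]]]] this]
  have Im: "Im \<in> R" by (simp add: continuous_on_Im)
  interpret function_ring_on R "spectrum a"
  proof
    show "compact (spectrum a)" by (rule compact_spectrum)
    show "continuous_on (spectrum a) g" if "g \<in> R" for g
      using that by (simp add: R_def)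
    show "(\<lambda>z. g z + h z) \<in> R" if "g \<in> R" "h \<in> R" for g h
    proof -
      obtain x y where "gelfand_rep a (\<lambda>z. complex_of_real (g z)) x"
        "gelfand_rep a (\<lambda>z. complex_of_real (h z)) y"
        and "continuous_on (spectrum a) g" "continuous_on (spectrum a) h"
        using \<open>g \<in> R\<close> \<open>h \<in> R\<close> by (auto simp: R_def)
      then show ?thesis
        by (intro RI[OF continuous_on_add gelfand_rep_add]) simp_all
    qed
    show "(\<lambda>z. g z * h z) \<in> R" if "g \<in> R" "h \<in> R" for g h
    proof -
      obtain x y where "gelfand_rep a (\<lambda>z. complex_of_real (g z)) x"
        "gelfand_rep a (\<lambda>z. complex_of_real (h z)) y"
        and "continuous_on (spectrum a) g" "continuous_on (spectrum a) h"
        using \<open>g \<in> R\<close> \<open>h \<in> R\<close> by (auto simp: R_def)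
      then show ?thesis
        by (intro RI[OF continuous_on_mult gelfand_rep_mult]) simp_all
    qed
    show "(\<lambda>_. c) \<in> R" for c
      by (rule RI[OF _ gelfand_rep_const]) auto
    show "\<exists>g\<in>R. g z \<noteq> g w" if "z \<noteq> w" for z w :: complex
      using that Re Im by (metis complex_eqI)
  qed
  obtain F where F: "\<And>n::nat. F n \<in> R" "uniform_limit (spectrum a) F f sequentially"
    using Stone_Weierstrass[OF f] by auto
  then obtain x where "\<And>n. gelfand_rep a (\<lambda>z. complex_of_real (F n z)) (x n)"
    unfolding R_def by simp metis
  moreover have "uniform_limit (spectrum a) (\<lambda>n z. complex_of_real (F n z)) (\<lambda>z. complex_of_real (f z)) sequentially"
    using F(2) by (simp add: uniform_limit_iff)
  ultimately show ?thesis by (rule gelfand_rep_limit[OF a])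
qed

lemma gelfand_rep_exists:
  assumes a: "a \<in> B" and f: "continuous_on (spectrum a) f"
  shows "\<exists>x. gelfand_rep a f x"
proof -
  obtain x where x: "gelfand_rep a (\<lambda>z. complex_of_real (Re (f z))) x"
    using gelfand_rep_exists_real[OF a continuous_on_Re[OF f]] by blast
  obtain y where y: "gelfand_rep a (\<lambda>z. complex_of_real (Im (f z))) y"
    using gelfand_rep_exists_real[OF a continuous_on_Im[OF f]] by blast
  have "(\<lambda>z. complex_of_real (Re (f z)) + \<i> * complex_of_real (Im (f z))) = f"
    by (simp add: complex_eq_iff fun_eq_iff)
  with gelfand_rep_add[OF x gelfand_rep_scaleC[OF y, of \<i>]] show ?thesis by auto
qed

end

section \<open>The bicommutant of a normal element\<close>

definition commutant :: "'a::times set \<Rightarrow> 'a set"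
  where "commutant S = {x. \<forall>y\<in>S. x * y = y * x}"

text \<open>Normality puts \<open>a\<close> and \<open>star a\<close> into their own commutant
  \<open>T\<close>, so \<open>B\<close> is contained in \<open>T\<close> and therefore commutes with
  itself. If \<open>y\<close> inverts \<open>x\<close> and \<open>z\<close> commutes with
  \<open>x\<close>, then \<open>y z = y z x y = y x z y = z y\<close>.\<close>

lemma bicommutant_of_normal:
  fixes a :: "'a::unital_cstar_algebra"
  assumes "normal_element a"
  defines "B \<equiv> commutant (commutant {a, star a})"
  shows "commutative_cstar_subalgebra B" "a \<in> B"
proof -
  define T where "T = commutant {a, star a}"
  have T: "y \<in> T \<longleftrightarrow> y * a = a * y \<and> y * star a = star a * y" for y
    by (auto simp: T_def commutant_def)
  have B: "x \<in> B \<longleftrightarrow> (\<forall>y\<in>T. x * y = y * x)" for x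
    by (simp add: B_def T_def commutant_def)
  have star_T: "star y \<in> T" if "y \<in> T" for y
    using that unfolding T by (metis star_mult star_star)
  have "a \<in> T" "star a \<in> T"
    using assms(1) by (auto simp: T normal_element_def)
  then have B_T: "x \<in> T" if "x \<in> B" for x
    using that by (auto simp: T B)
  show "a \<in> B" by (auto simp: B T)
  show "commutative_cstar_subalgebra B"
  proof
    have "B = (\<Inter>y\<in>T. {x. x * y = y * x})" by (auto simp: B)
    moreover have "closed {x. x * y = y * x}" for y :: 'a
      by (intro closed_Collect_eq continuous_intros)
    ultimately show "closed B" by auto
    show "x * y \<in> B" if "x \<in> B" "y \<in> B" for x y
      using that unfolding B by (metis mult.assoc)
    show "star x \<in> B" if "x \<in> B" for x
      using that star_T unfolding B by (metis star_mult star_star)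
    show "x * y = y * x" if "x \<in> B" "y \<in> B" for x y
      using that(1) B_T[OF that(2)] by (simp add: B)
    show "y \<in> B" if "x \<in> B" "x * y = 1" "y * x = 1" for x y
      unfolding B
    proof
      fix z assume "z \<in> T"
      have "y * z = y * (z * x) * y" using that(2) by (simp add: mult.assoc)
      also have "z * x = x * z" using that(1) \<open>z \<in> T\<close> by (simp add: B)
      also have "y * (x * z) * y = z * y" using that(3) by (simp add: mult.assoc[symmetric])
      finally show "y * z = z * y" .
    qed
  qed (auto simp: B algebra_simps)
qed


section \<open>The compact-open topology\<close>

lemma topspace_C0_topology [simp]: "topspace (C0_topology s) = C0 s"
proof -
  let ?S = "{{f \<in> C0 s. f ` K \<subseteq> U} | K U. compact K \<and> K \<subseteq> s \<and> open U}"
  have "{f \<in> C0 s. f ` {} \<subseteq> {}} \<in> ?S" by blast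
  then have "C0 s \<in> ?S" by simp
  moreover have "\<Union>?S \<subseteq> C0 s" by blast
  ultimately show ?thesis
    unfolding C0_topology_def topology_generated_by_topspace by (intro antisym Union_upper)
qed

lemma openin_C0_topology_subbasic:
  "compact K \<Longrightarrow> K \<subseteq> s \<Longrightarrow> open U \<Longrightarrow> openin (C0_topology s) {f \<in> C0 s. f ` K \<subseteq> U}"
  unfolding C0_topology_def by (rule topology_generated_by_Basis) blast

lemma C0_diff: "f \<in> C0 s \<Longrightarrow> g \<in> C0 s \<Longrightarrow> (\<lambda>z. f z - g z) \<in> C0 s"
  by (auto simp: C0_def intro: continuous_on_diff)

lemma C0_mult: "f \<in> C0 s \<Longrightarrow> g \<in> C0 s \<Longrightarrow> (\<lambda>z. f z * g z) \<in> C0 s"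
  by (auto simp: C0_def intro: continuous_on_mult)

lemma C0_cnj: "f \<in> C0 s \<Longrightarrow> (\<lambda>z. cnj (f z)) \<in> C0 s"
  by (auto simp: C0_def intro: continuous_on_cnj)

lemma C0_id_in_C0: "C0_id s \<in> C0 s"
proof -
  have "continuous_on s (C0_id s)"
    by (rule continuous_on_eq[OF continuous_on_id]) (simp add: C0_id_def)
  then show ?thesis by (simp add: C0_def C0_id_def)
qed

text \<open>By uniform continuity \<open>f\<close> varies by less than \<open>e / 2\<close> on each
  of finitely many small compact pieces covering \<open>s\<close>. Keeping \<open>g\<close> within
  \<open>e / 2\<close> of the value of \<open>f\<close> at the centre, on every piece, is a finite
  intersection of subbasic conditions.\<close>

lemma C0_topology_uniform_neighbourhood:
  assumes s: "compact s" and f: "f \<in> C0 s" and "e > 0"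
  obtains V where "openin (C0_topology s) V" "f \<in> V"
    "\<And>g z. g \<in> V \<Longrightarrow> z \<in> s \<Longrightarrow> cmod (g z - f z) < e"
proof -
  have cont: "continuous_on s f" using f by (simp add: C0_def)
  have "uniformly_continuous_on s f" by (rule compact_uniformly_continuous[OF cont s])
  then obtain d where "d > 0" and d: "\<And>z w. z \<in> s \<Longrightarrow> w \<in> s \<Longrightarrow> dist w z < d \<Longrightarrow> dist (f w) (f z) < e / 2"
    using \<open>e > 0\<close> by (elim uniformly_continuous_onE[of _ _ "e / 2"]) auto
  have cover: "s \<subseteq> (\<Union>c\<in>s. ball c (d / 2))" using \<open>d > 0\<close> by auto
  obtain T where T: "T \<subseteq> s" "finite T" "s \<subseteq> (\<Union>c\<in>T. ball c (d / 2))"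
    by (rule compactE_image[OF s open_ball cover])
  define K where "K c = s \<inter> cball c (d / 2)" for c
  define W where "W c = {g \<in> C0 s. g ` K c \<subseteq> ball (f c) (e / 2)}" for c
  \<comment> \<open>Intersecting with \<open>C0 s\<close> matters when \<open>T\<close> is empty,
    since the empty intersection is the whole type.\<close>
  define V where "V = (\<Inter>c\<in>T. W c) \<inter> C0 s"
  show ?thesis
  proof
    have W: "openin (C0_topology s) (W c)" for c
      unfolding W_def K_def by (intro openin_C0_topology_subbasic compact_Int_closed s) auto
    show "openin (C0_topology s) V"
      unfolding V_def using openin_INT[OF T(2) W] by simp
    have "f \<in> W c" if "c \<in> T" for c
    proof -
      have "f z \<in> ball (f c) (e / 2)" if "z \<in> K c" for z
        using d[of c z] that \<open>c \<in> T\<close> T(1) \<open>d > 0\<close> by (auto simp: K_def dist_commute)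
      then show ?thesis using f by (auto simp: W_def)
    qed
    then show "f \<in> V" using f by (auto simp: V_def)
    fix g z assume "g \<in> V" "z \<in> s"
    then obtain c where c: "c \<in> T" "z \<in> ball c (d / 2)" using T(3) by blast
    then have "z \<in> K c" using \<open>z \<in> s\<close> by (auto simp: K_def)
    then have "g z \<in> ball (f c) (e / 2)"
      using \<open>g \<in> V\<close> c(1) unfolding V_def W_def by blast
    then have "dist (g z) (f c) < e / 2" by (simp add: dist_commute)
    moreover have "dist (f z) (f c) < e / 2"
      using d[of c z] c T(1) \<open>z \<in> s\<close> \<open>d > 0\<close> by (auto simp: dist_commute)
    ultimately have "dist (g z) (f z) < e" by (rule dist_triangle_half_l)
    then show "cmod (g z - f z) < e" by (simp add: dist_norm)
  qed
qed

text \<open>\<open>le\<close> and \<open>attained\<close> say that \<open>norm (\<phi> f)\<close> is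
  the maximum of \<open>cmod (f z)\<close> on \<open>s\<close>, so by \<open>diff\<close> the map is
  isometric for the uniform distance. What remains is to compare uniform and compact-open
  neighbourhoods in both directions and to use completeness for the closed range.\<close>

lemma closed_embedding_map_isometry:
  fixes \<phi> :: "(complex \<Rightarrow> complex) \<Rightarrow> 'b::banach"
  assumes s: "compact s"
    and diff: "\<And>f g. f \<in> C0 s \<Longrightarrow> g \<in> C0 s \<Longrightarrow> \<phi> (\<lambda>z. f z - g z) = \<phi> f - \<phi> g"
    and le: "\<And>f z. f \<in> C0 s \<Longrightarrow> z \<in> s \<Longrightarrow> cmod (f z) \<le> norm (\<phi> f)"
    and attained: "\<And>f. f \<in> C0 s \<Longrightarrow> \<exists>z\<in>s. norm (\<phi> f) = cmod (f z)"
  shows "closed_embedding_map (C0_topology s) euclidean \<phi>"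
proof -
  have dist_le: "cmod (f z - g z) \<le> dist (\<phi> f) (\<phi> g)" if "f \<in> C0 s" "g \<in> C0 s" "z \<in> s" for f g z
    using le[OF C0_diff[OF that(1,2)] that(3)] diff[OF that(1,2)] by (simp add: dist_norm)
  have dist_attained: "\<exists>z\<in>s. dist (\<phi> f) (\<phi> g) = cmod (f z - g z)" if "f \<in> C0 s" "g \<in> C0 s" for f g
    using attained[OF C0_diff[OF that]] diff[OF that] by (simp add: dist_norm)
  have inj: "inj_on \<phi> (C0 s)"
  proof (rule inj_onI, rule ext)
    fix f g z assume fg: "f \<in> C0 s" "g \<in> C0 s" "\<phi> f = \<phi> g"
    show "f z = g z"
      using dist_le[OF fg(1,2), of z] fg by (cases "z \<in> s") (auto simp: C0_def)
  qed
  have cont: "continuous_map (C0_topology s) euclidean \<phi>"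
  proof (clarsimp simp: continuous_map_def)
    fix U :: "'b set" assume "open U"
    show "openin (C0_topology s) {f \<in> C0 s. \<phi> f \<in> U}"
    proof (subst openin_subopen, clarify)
      fix f assume f: "f \<in> C0 s" "\<phi> f \<in> U"
      obtain e where e: "e > 0" "ball (\<phi> f) e \<subseteq> U"
        using \<open>open U\<close> f(2) openE by blast
      obtain V where V: "openin (C0_topology s) V" "f \<in> V"
        "\<And>g z. g \<in> V \<Longrightarrow> z \<in> s \<Longrightarrow> cmod (g z - f z) < e"
        using C0_topology_uniform_neighbourhood[OF s f(1) e(1)] by blast
      have "g \<in> {f \<in> C0 s. \<phi> f \<in> U}" if "g \<in> V" for g
      proof -
        have g: "g \<in> C0 s" using openin_subset[OF V(1)] that by auto
        obtain z where "z \<in> s" "dist (\<phi> g) (\<phi> f) = cmod (g z - f z)"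
          using dist_attained[OF g f(1)] by blast
        then have "\<phi> g \<in> ball (\<phi> f) e" using V(3)[OF that] by (simp add: dist_commute)
        with g e(2) show ?thesis by blast
      qed
      with V show "\<exists>T. openin (C0_topology s) T \<and> f \<in> T \<and> T \<subseteq> {f \<in> C0 s. \<phi> f \<in> U}" by blast
    qed
  qed
  define \<theta> where "\<theta> = inv_into (C0 s) \<phi>"
  have \<theta>: "\<And>f. f \<in> C0 s \<Longrightarrow> \<theta> (\<phi> f) = f" "\<And>x. x \<in> \<phi> ` C0 s \<Longrightarrow> \<phi> (\<theta> x) = x"
    unfolding \<theta>_def using inj by (auto simp: f_inv_into_f)
  have inv_cont: "continuous_map (top_of_set (\<phi> ` C0 s)) (C0_topology s) \<theta>"
    unfolding C0_topology_def
  proof (rule continuous_on_generated_topo)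
    fix N assume "N \<in> {{f \<in> C0 s. f ` K \<subseteq> U} | K U. compact K \<and> K \<subseteq> s \<and> open U}"
    then obtain K U where N: "N = {f \<in> C0 s. f ` K \<subseteq> U}" and K: "compact K" "K \<subseteq> s" and U: "open U"
      by blast
    show "openin (top_of_set (\<phi> ` C0 s)) (\<theta> -` N \<inter> topspace (top_of_set (\<phi> ` C0 s)))"
      unfolding openin_euclidean_subtopology_iff
    proof (intro conjI ballI)
      fix x assume "x \<in> \<theta> -` N \<inter> topspace (top_of_set (\<phi> ` C0 s))"
      then obtain f where f: "f \<in> C0 s" "x = \<phi> f" "f ` K \<subseteq> U"
        using \<theta>(1) by (auto simp: N)
      have "compact (f ` K)"
        using f(1) K by (intro compact_continuous_image) (auto simp: C0_def intro: continuous_on_subset)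
      \<comment> \<open>A compact image inside an open set leaves a uniform margin \<open>e\<close>,
        so uniform closeness implies the subbasic condition.\<close>
      then obtain e where e: "e > 0" "(\<Union>w\<in>f ` K. ball w e) \<subseteq> U"
        using compact_subset_open_imp_ball_epsilon_subset[OF _ U f(3)] by blast
      have "y \<in> \<theta> -` N \<inter> topspace (top_of_set (\<phi> ` C0 s))"
        if y: "y \<in> \<phi> ` C0 s" "dist y x < e" for y
      proof -
        obtain g where g: "g \<in> C0 s" "y = \<phi> g" using y(1) by blast
        have "g z \<in> U" if "z \<in> K" for z
        proof -
          have "cmod (g z - f z) < e"
            using dist_le[OF g(1) f(1), of z] y(2) that K(2) g(2) f(2) by force
          then have "g z \<in> ball (f z) e" by (simp add: dist_norm norm_minus_commute)
          then show ?thesis using e(2) that by blast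
        qed
        then show ?thesis using g \<theta>(1) by (auto simp: N)
      qed
      then show "\<exists>e>0. \<forall>y\<in>\<phi> ` C0 s. dist y x < e \<longrightarrow>
          y \<in> \<theta> -` N \<inter> topspace (top_of_set (\<phi> ` C0 s))"
        using e(1) by blast
    qed auto
  next
    have "\<Union>{{f \<in> C0 s. f ` K \<subseteq> U} | K U. compact K \<and> K \<subseteq> s \<and> open U} = C0 s"
      using topspace_C0_topology[of s] unfolding C0_topology_def topology_generated_by_topspace .
    then show "\<theta> ` topspace (top_of_set (\<phi> ` C0 s))
        \<subseteq> \<Union>{{f \<in> C0 s. f ` K \<subseteq> U} | K U. compact K \<and> K \<subseteq> s \<and> open U}"
      using \<theta>(1) by auto
  qed
  have "homeomorphic_maps (C0_topology s) (top_of_set (\<phi> ` C0 s)) \<phi> \<theta>"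
    unfolding homeomorphic_maps_def
    using cont inv_cont \<theta> by (simp add: continuous_map_in_subtopology)
  then have "embedding_map (C0_topology s) euclidean \<phi>"
    unfolding embedding_map_def homeomorphic_map_maps by auto
  moreover have "closed (\<phi> ` C0 s)"
    unfolding closed_sequential_limits
  proof (intro allI impI, elim conjE)
    fix x l assume "\<forall>n. x n \<in> \<phi> ` C0 s" and l: "x \<longlonglongrightarrow> l"
    then have "\<forall>n. \<exists>f. f \<in> C0 s \<and> x n = \<phi> f" by blast
    then obtain f where f: "\<And>n. f n \<in> C0 s" "\<And>n. x n = \<phi> (f n)" by metis
    have "Cauchy x" using l by (rule LIMSEQ_imp_Cauchy)
    have "uniformly_Cauchy_on s f"
    proof (rule uniformly_Cauchy_onI)
      fix e :: real assume "e > 0"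
      then obtain M where "\<And>m n. m \<ge> M \<Longrightarrow> n \<ge> M \<Longrightarrow> dist (x m) (x n) < e"
        using \<open>Cauchy x\<close> unfolding Cauchy_def by meson
      then show "\<exists>M. \<forall>z\<in>s. \<forall>m\<ge>M. \<forall>n\<ge>M. dist (f m z) (f n z) < e"
        using dist_le[OF f(1) f(1)] unfolding f(2) by (metis dist_norm le_less_trans)
    qed
    then obtain h where h: "uniform_limit s f h sequentially"
      using Cauchy_uniformly_convergent unfolding uniformly_convergent_on_def by blast
    \<comment> \<open>The uniform limit is determined only on \<open>s\<close>; members of
      \<open>C0 s\<close> must vanish elsewhere.\<close>
    define g where "g z = (if z \<in> s then h z else 0)" for z
    have lim: "uniform_limit s f g sequentially"
      using h by (rule uniform_limit_cong'[THEN iffD1, rotated -1]) (auto simp: g_def)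
    have "g 0 = 0"
    proof (cases "0 \<in> s")
      case True
      have "(\<lambda>n. f n 0) \<longlonglongrightarrow> g 0" by (rule tendsto_uniform_limitI[OF lim True])
      then show ?thesis using f(1) by (simp add: C0_def LIMSEQ_const_iff)
    qed (simp add: g_def)
    moreover have "continuous_on s g"
      by (rule uniform_limit_theorem[OF _ lim]) (use f(1) in \<open>auto simp: C0_def\<close>)
    ultimately have g: "g \<in> C0 s" by (simp add: C0_def g_def)
    have "x \<longlonglongrightarrow> \<phi> g"
    proof (rule metric_LIMSEQ_I)
      fix e :: real assume "e > 0"
      then obtain M where M: "\<And>n z. n \<ge> M \<Longrightarrow> z \<in> s \<Longrightarrow> dist (f n z) (g z) < e"
        using lim unfolding uniform_limit_iff eventually_sequentially by meson
      have "dist (x n) (\<phi> g) < e" if "n \<ge> M" for n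
        using dist_attained[OF f(1)[of n] g] M[OF that] by (auto simp: f(2) dist_norm)
      then show "\<exists>no. \<forall>n\<ge>no. dist (x n) (\<phi> g) < e" by blast
    qed
    then have "l = \<phi> g" using l LIMSEQ_unique by blast
    then show "l \<in> \<phi> ` C0 s" using g by blast
  qed
  ultimately show ?thesis by (simp add: closed_embedding_map_def)
qed

section \<open>The non-unital functional calculus\<close>

text \<open>The embedding of \<open>A\<close> is isometric, which carries norm formulas from the
  unitization back to \<open>A\<close>.\<close>

lemma norm_Unitization_zero: "norm (Unitization 0 a) = norm a" for a :: "'a::nonunital_cstar_algebra"
proof (rule antisym)
  show "norm (Unitization 0 a) \<le> norm a"
    by (rule norm_unitization_le) (simp_all add: lmult_def norm_mult_ineq)
  show "norm a \<le> norm (Unitization 0 a)"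
    using norm_elt_le[of "Unitization 0 a"] by simp
qed

text \<open>In the unitization, \<open>(1 + x) (1 + y) = 1 + (x + y + x y)\<close>. Any inverse of
  \<open>1 + x\<close> has scalar part 1, hence the form \<open>1 + y\<close>.\<close>

lemma quasiregular_iff_invertible_elt:
  "quasiregular x \<longleftrightarrow> invertible_elt (1 + Unitization 0 x)" for x :: "'a::complex_algebra"
proof
  assume "quasiregular x"
  then obtain y where y: "x + y + x * y = 0" "y + x + y * x = 0" by (auto simp: quasiregular_def)
  then show "invertible_elt (1 + Unitization 0 x)"
    unfolding invertible_elt_def
    by (intro exI[of _ "1 + Unitization 0 y"]) (auto intro!: unitization.expand simp: algebra_simps)
next
  assume "invertible_elt (1 + Unitization 0 x)"
  then obtain u where u: "(1 + Unitization 0 x) * u = 1" "u * (1 + Unitization 0 x) = 1"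
    by (auto simp: invertible_elt_def)
  have "scal u = 1" using arg_cong[OF u(1), of scal] by simp
  moreover have "elt ((1 + Unitization 0 x) * u) = 0" "elt (u * (1 + Unitization 0 x)) = 0"
    unfolding u by simp_all
  ultimately show "quasiregular x"
    unfolding quasiregular_def by (intro exI[of _ "elt u"]) (simp add: algebra_simps)
qed

text \<open>At \<open>r = 0\<close> both sides hold, since \<open>scal\<close> is multiplicative and
  an element with scalar part 0 has no inverse. For other \<open>r\<close>, \<open>a - r\<close> is
  \<open>- r\<close> times \<open>1 - inverse r a\<close>.\<close>

lemma quasispectrum_eq_spectrum:
  "quasispectrum a = spectrum (Unitization 0 a)" for a :: "'a::complex_algebra"
proof -
  have zero: "\<not> invertible_elt (Unitization 0 a)"
  proof
    assume "invertible_elt (Unitization 0 a)"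
    then obtain u where "Unitization 0 a * u = 1" by (auto simp: invertible_elt_def)
    from arg_cong[OF this, of scal] show False by simp
  qed
  have nonzero: "quasiregular (- (inverse r *\<^sub>C a)) \<longleftrightarrow> invertible_elt (Unitization 0 a - r *\<^sub>C 1)"
    if "r \<noteq> 0" for r
  proof -
    define u where "u = 1 + Unitization 0 (- (inverse r *\<^sub>C a))"
    have u: "Unitization 0 a - r *\<^sub>C 1 = (- r) *\<^sub>C u"
      "u = (- inverse r) *\<^sub>C (Unitization 0 a - r *\<^sub>C 1)"
      using that by (auto intro!: unitization.expand simp: u_def)
    have "invertible_elt u \<longleftrightarrow> invertible_elt (Unitization 0 a - r *\<^sub>C 1)"
    proof
      assume "invertible_elt u"
      then show "invertible_elt (Unitization 0 a - r *\<^sub>C 1)"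
        unfolding u(1) by (rule invertible_elt_scaleC) (use that in simp)
    next
      assume "invertible_elt (Unitization 0 a - r *\<^sub>C 1)"
      then have "invertible_elt ((- inverse r) *\<^sub>C (Unitization 0 a - r *\<^sub>C 1))"
        by (rule invertible_elt_scaleC) (use that in simp)
      then show "invertible_elt u" by (simp only: u(2)[symmetric])
    qed
    then show ?thesis by (simp add: quasiregular_iff_invertible_elt u_def)
  qed
  show ?thesis
  proof (intro set_eqI)
    show "r \<in> quasispectrum a \<longleftrightarrow> r \<in> spectrum (Unitization 0 a)" for r
      using zero nonzero[of r] by (cases "r = 0") (simp_all add: quasispectrum_def spectrum_def)
  qed
qed

lemma nonunital_functional_calculus:
  fixes a :: "'a::nonunital_cstar_algebra"
  assumes "normal_element a"
  obtains \<phi> :: "(complex \<Rightarrow> complex) \<Rightarrow> 'a" where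
    "C0_star_hom (quasispectrum a) \<phi>"
    "\<phi> (C0_id (quasispectrum a)) = a"
    "\<And>f. f \<in> C0 (quasispectrum a) \<Longrightarrow> quasispectrum (\<phi> f) = f ` quasispectrum a"
    "\<And>f z. f \<in> C0 (quasispectrum a) \<Longrightarrow> z \<in> quasispectrum a \<Longrightarrow> cmod (f z) \<le> norm (\<phi> f)"
    "\<And>f. f \<in> C0 (quasispectrum a) \<Longrightarrow> \<exists>z\<in>quasispectrum a. norm (\<phi> f) = cmod (f z)"
proof -
  define b where "b = Unitization 0 a"
  define s where "s = quasispectrum a"
  have s: "s = spectrum b" by (simp add: s_def b_def quasispectrum_eq_spectrum)
  have "normal_element b"
    using assms unfolding normal_element_def b_def by (auto intro!: unitization.expand)
  note bic = bicommutant_of_normal[OF this]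
  define B where "B = commutant (commutant {b, star b})"
  interpret commutative_cstar_subalgebra B unfolding B_def by (rule bic(1))
  have b: "b \<in> B" unfolding B_def by (rule bic(2))
  define \<phi> where "\<phi> f = elt (THE x. gelfand_rep b f x)" for f
  have scal: "character scal" by (simp add: character_def)
  have rep: "gelfand_rep b f (Unitization 0 (\<phi> f))" if f: "f \<in> C0 s" for f
  proof -
    have "continuous_on (spectrum b) f" using f by (simp add: C0_def s)
    then obtain x where x: "gelfand_rep b f x" using gelfand_rep_exists[OF b] by blast
    then have "(THE x. gelfand_rep b f x) = x"
      using gelfand_rep_unique[OF b] by blast
    moreover have "scal x = 0"
      using gelfand_repD(2)[OF x scal] f by (simp add: b_def C0_def)
    ultimately have "Unitization 0 (\<phi> f) = x" by (auto intro!: unitization.expand simp: \<phi>_def)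
    with x show ?thesis by simp
  qed
  \<comment> \<open>Each identity for \<open>\<phi>\<close> follows from uniqueness: both sides
    represent functions that agree on the spectrum.\<close>
  have eqI: "\<phi> f = y" if "f \<in> C0 s" "gelfand_rep b g x" "\<And>z. z \<in> s \<Longrightarrow> f z = g z" "elt x = y" for f g x y
  proof -
    have "Unitization 0 (\<phi> f) = x"
      using gelfand_rep_unique[OF b gelfand_rep_cong[OF b rep[OF that(1)]] that(2)] that(3) s by blast
    then show ?thesis using that(4) by auto
  qed
  show ?thesis
  proof (rule that[of \<phi>, folded s_def])
    have add_C0: "(\<lambda>z. f z + g z) \<in> C0 s" if "f \<in> C0 s" "g \<in> C0 s" for f g
      using that by (auto simp: C0_def intro: continuous_on_add)
    have scale_C0: "(\<lambda>z. c * f z) \<in> C0 s" if "f \<in> C0 s" for f c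
      using that by (auto simp: C0_def intro: continuous_on_mult continuous_on_const)
    show "C0_star_hom s \<phi>"
      unfolding C0_star_hom_def
    proof (intro conjI ballI allI)
      fix f assume f: "f \<in> C0 s"
      show "\<phi> (\<lambda>z. c * f z) = c *\<^sub>C \<phi> f" for c
        by (rule eqI[OF scale_C0[OF f] gelfand_rep_scaleC[OF rep[OF f]]]) auto
      show "\<phi> (\<lambda>z. cnj (f z)) = star (\<phi> f)"
        by (rule eqI[OF C0_cnj[OF f] gelfand_rep_star[OF rep[OF f]]]) auto
      fix g assume g: "g \<in> C0 s"
      show "\<phi> (\<lambda>z. f z + g z) = \<phi> f + \<phi> g"
        by (rule eqI[OF add_C0[OF f g] gelfand_rep_add[OF rep[OF f] rep[OF g]]]) auto
      show "\<phi> (\<lambda>z. f z * g z) = \<phi> f * \<phi> g"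
        by (rule eqI[OF C0_mult[OF f g] gelfand_rep_mult[OF rep[OF f] rep[OF g]]]) auto
    qed
    show "\<phi> (C0_id s) = a"
      by (rule eqI[OF C0_id_in_C0 gelfand_rep_id[OF b]]) (auto simp: C0_id_def b_def)
    fix f assume f: "f \<in> C0 s"
    show "quasispectrum (\<phi> f) = f ` s"
      using gelfand_rep_spectrum[OF b rep[OF f]] by (simp add: quasispectrum_eq_spectrum s)
    show "cmod (f z) \<le> norm (\<phi> f)" if "z \<in> s" for z
      using gelfand_rep_norm_le[OF b rep[OF f]] that by (simp add: norm_Unitization_zero s)
    show "\<exists>z\<in>s. norm (\<phi> f) = cmod (f z)"
      using gelfand_rep_norm_attained[OF b rep[OF f]] by (simp add: norm_Unitization_zero s)
  qed
qed

theorem mainTheorem1: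
  shows "normal_element (0::'a::nonunital_cstar_algebra) \<and>
    (\<forall>a::'a. compact (quasispectrum a)) \<and>
    (\<forall>a::'a. normal_element a \<longrightarrow>
      (\<exists>\<phi> :: (complex \<Rightarrow> complex) \<Rightarrow> 'a.
        C0_star_hom (quasispectrum a) \<phi> \<and>
        closed_embedding_map (C0_topology (quasispectrum a)) euclidean \<phi> \<and>
        \<phi> (C0_id (quasispectrum a)) = a \<and>
        (\<forall>f\<in>C0 (quasispectrum a). quasispectrum (\<phi> f) = f ` quasispectrum a) \<and>
        (\<forall>f\<in>C0 (quasispectrum a). normal_element (\<phi> f))))"
proof (intro conjI allI impI)
  show "normal_element (0::'a)" by (simp add: normal_element_def)
  show compact: "compact (quasispectrum a)" for a :: 'a
    by (simp add: quasispectrum_eq_spectrum compact_spectrum)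
  fix a :: 'a
  assume a: "normal_element a"
  let ?s = "quasispectrum a"
  obtain \<phi> :: "(complex \<Rightarrow> complex) \<Rightarrow> 'a" where
    hom: "C0_star_hom ?s \<phi>" and id: "\<phi> (C0_id ?s) = a"
    and spec: "\<And>f. f \<in> C0 ?s \<Longrightarrow> quasispectrum (\<phi> f) = f ` ?s"
    and le: "\<And>f z. f \<in> C0 ?s \<Longrightarrow> z \<in> ?s \<Longrightarrow> cmod (f z) \<le> norm (\<phi> f)"
    and attained: "\<And>f. f \<in> C0 ?s \<Longrightarrow> \<exists>z\<in>?s. norm (\<phi> f) = cmod (f z)"
    using nonunital_functional_calculus[OF a] by blast
  have add: "\<phi> (\<lambda>z. f z + g z) = \<phi> f + \<phi> g" if "f \<in> C0 ?s" "g \<in> C0 ?s" for f g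
    using hom that unfolding C0_star_hom_def by blast
  have mult: "\<phi> (\<lambda>z. f z * g z) = \<phi> f * \<phi> g" if "f \<in> C0 ?s" "g \<in> C0 ?s" for f g
    using hom that unfolding C0_star_hom_def by blast
  have cnj: "\<phi> (\<lambda>z. cnj (f z)) = star (\<phi> f)" if "f \<in> C0 ?s" for f
    using hom that unfolding C0_star_hom_def by blast
  have diff: "\<phi> (\<lambda>z. f z - g z) = \<phi> f - \<phi> g" if f: "f \<in> C0 ?s" and g: "g \<in> C0 ?s" for f g
  proof -
    from add[OF C0_diff[OF f g] g] show ?thesis by simp
  qed
  have "closed_embedding_map (C0_topology ?s) euclidean \<phi>"
    by (rule closed_embedding_map_isometry[OF compact diff le attained])
  \<comment> \<open>Both products are images of functions, and pointwise multiplication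
    commutes.\<close>
  moreover have "normal_element (\<phi> f)" if f: "f \<in> C0 ?s" for f
    unfolding normal_element_def cnj[OF f, symmetric] mult[OF f C0_cnj[OF f], symmetric]
      mult[OF C0_cnj[OF f] f, symmetric] by (simp add: mult.commute)
  ultimately show "\<exists>\<phi> :: (complex \<Rightarrow> complex) \<Rightarrow> 'a.
        C0_star_hom ?s \<phi> \<and>
        closed_embedding_map (C0_topology ?s) euclidean \<phi> \<and>
        \<phi> (C0_id ?s) = a \<and>
        (\<forall>f\<in>C0 ?s. quasispectrum (\<phi> f) = f ` ?s) \<and>
        (\<forall>f\<in>C0 ?s. normal_element (\<phi> f))"
    using hom id spec by blast
qed

end
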